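(* The bones in $P^{Q}=[0,1]^2$ are smooth $\mathcal{C}^1$ curves that intersect transversally (that is, every left bone and every right bone is a $\mathcal{C}^1$ smooth curve, and wherever two bones intersect they do so transversally).
   Context: For $v\in[0,1]$ let $q_v(x)=4vx(1-x)$. The parameter space is $P^{Q}=[0,1]^2$, the point $(v,w)$ corresponding to the pair $(q_v,q_w)$, viewed as $q_v:I_1\to I_2$ and $q_w:I_2\to I_1$, where $I_1,I_2$ are two disjoint copies of $[0,1]$, with critical points $\gamma_1=\frac12\in I_1$ and $\gamma_2=\frac12\in I_2$. Orbits under a pair $(h_1,h_2)$, $h_1:I_1\to I_2$, $h_2:I_2\to I_1$, are obtained by applying $h_1$ and $h_2$ alternately. A point $x\in I_1$ (resp. $y\in I_2$) is periodic of period $2n$ if $n$ is the least positive integer with $(h_2\circ h_1)^{\circ n}(x)=x$ (resp. $(h_1\circ h_2)^{\circ n}(y)=y$). Such an orbit has $n$ points $x_1<\dots<x_n$ in $I_1$ and $n$ points $y_1<\dots<y_n$ in $I_2$; its order-data is the pair of permutations $(\sigma,\tau)\in S_n^2$ with $h_1(x_i)=y_{\sigma(i)}$ and $h_2(y_j)=x_{\tau(j)}$. A boundary anchored $(+,-)$ unimodal map is a map $h:[0,1]\to[0,1]$ with $h(0)=h(1)=0$, increasing on $(0,\gamma)$ and decreasing on $(\gamma,1)$ for some $\gamma\in(0,1)$. The order-data $(\sigma,\tau)$ is admissible if it is realized by a periodic orbit of some pair of such maps. For admissible $(\sigma,\tau)\in S_n^2$, the left bone $B^Q_L(\sigma,\tau)$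 is the set of $(v,w)\in P^{Q}$ such that $\gamma_1$ is periodic of period $2n$ under $(q_v,q_w)$ with order-data $(\sigma,\tau)$; the right bone $B^Q_R(\sigma,\tau)$ is the set of $(v,w)\in P^{Q}$ such that $\gamma_2$ is periodic of period $2n$ with order-data $(\sigma,\tau)$. *)

theory Defs
  imports "HOL-Analysis.Analysis" "HOL-Combinatorics.Permutations"
begin

text \<open>
  Both copies \<open>I\<^sub>1\<close> and \<open>I\<^sub>2\<close> of the unit interval are represented by \<open>{0..1} :: real set\<close>.
  They are kept apart by the role of the maps only: the first map always goes from
  \<open>I\<^sub>1\<close> to \<open>I\<^sub>2\<close> and the second one from \<open>I\<^sub>2\<close> to \<open>I\<^sub>1\<close>.
\<close>

definition q :: "real \<Rightarrow> real \<Rightarrow> real" where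
  "q v x = 4 * v * x * (1 - x)"

definition param_space :: "(real \<times> real) set" where
  "param_space = {0..1} \<times> {0..1}"

definition anchored_unimodal :: "(real \<Rightarrow> real) \<Rightarrow> bool" where
  "anchored_unimodal h \<longleftrightarrow>
     h ` {0..1} \<subseteq> {0..1} \<and> continuous_on {0..1} h \<and> h 0 = 0 \<and> h 1 = 0 \<and>
     (\<exists>\<gamma>. 0 < \<gamma> \<and> \<gamma> < 1 \<and>
        strict_mono_on {0<..<\<gamma>} h \<and> strict_antimono_on {\<gamma><..<1} h)"


subsection \<open>Periodic orbits and their order-data\<close>

text \<open>
  Here \<open>f\<close> is a first return map, \<open>h\<^sub>2 \<circ> h\<^sub>1\<close> or \<open>h\<^sub>1 \<circ> h\<^sub>2\<close>, so that \<open>least_period f n x\<close> means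
  that the orbit of \<open>x\<close> under the alternating pair has period \<open>2n\<close>.
\<close>

definition least_period :: "('a \<Rightarrow> 'a) \<Rightarrow> nat \<Rightarrow> 'a \<Rightarrow> bool" where
  "least_period f n x \<longleftrightarrow>
     0 < n \<and> (f ^^ n) x = x \<and> (\<forall>m. 0 < m \<and> m < n \<longrightarrow> (f ^^ m) x \<noteq> x)"

definition forward_orbit :: "('a \<Rightarrow> 'a) \<Rightarrow> 'a \<Rightarrow> 'a set" where
  "forward_orbit f x = range (\<lambda>k. (f ^^ k) x)"

text \<open>
  \<open>X\<close> and \<open>Y\<close> are the parts of the orbit in \<open>I\<^sub>1\<close> and \<open>I\<^sub>2\<close>; the strictly increasing \<open>x\<close> and \<open>y\<close>
  list their points as \<open>x 1 < \<dots> < x n\<close> and \<open>y 1 < \<dots> < y n\<close>.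
\<close>

definition has_order_data ::
  "(real \<Rightarrow> real) \<Rightarrow> (real \<Rightarrow> real) \<Rightarrow> real set \<Rightarrow> real set \<Rightarrow>
   nat \<Rightarrow> (nat \<Rightarrow> nat) \<Rightarrow> (nat \<Rightarrow> nat) \<Rightarrow> bool" where
  "has_order_data h1 h2 X Y n \<sigma> \<tau> \<longleftrightarrow>
     \<sigma> permutes {1..n} \<and> \<tau> permutes {1..n} \<and>
     (\<exists>x y. strict_mono_on {1..n} x \<and> x ` {1..n} = X \<and>
            strict_mono_on {1..n} y \<and> y ` {1..n} = Y \<and>
            (\<forall>i\<in>{1..n}. h1 (x i) = y (\<sigma> i)) \<and>
            (\<forall>j\<in>{1..n}. h2 (y j) = x (\<tau> j)))"

definition periodic_on_I1 ::
  "(real \<Rightarrow> real) \<Rightarrow> (real \<Rightarrow> real) \<Rightarrow> real \<Rightarrow> nat \<Rightarrow> (nat \<Rightarrow> nat) \<Rightarrow> (nat \<Rightarrow> nat) \<Rightarrow> bool" where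
  "periodic_on_I1 h1 h2 x n \<sigma> \<tau> \<longleftrightarrow>
     least_period (h2 \<circ> h1) n x \<and>
     has_order_data h1 h2 (forward_orbit (h2 \<circ> h1) x) (h1 ` forward_orbit (h2 \<circ> h1) x) n \<sigma> \<tau>"

definition periodic_on_I2 ::
  "(real \<Rightarrow> real) \<Rightarrow> (real \<Rightarrow> real) \<Rightarrow> real \<Rightarrow> nat \<Rightarrow> (nat \<Rightarrow> nat) \<Rightarrow> (nat \<Rightarrow> nat) \<Rightarrow> bool" where
  "periodic_on_I2 h1 h2 y n \<sigma> \<tau> \<longleftrightarrow>
     least_period (h1 \<circ> h2) n y \<and>
     has_order_data h1 h2 (h2 ` forward_orbit (h1 \<circ> h2) y) (forward_orbit (h1 \<circ> h2) y) n \<sigma> \<tau>"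

text \<open>Every periodic orbit meets \<open>I\<^sub>1\<close>, so it suffices to look at orbits starting there.\<close>

definition admissible :: "nat \<Rightarrow> (nat \<Rightarrow> nat) \<Rightarrow> (nat \<Rightarrow> nat) \<Rightarrow> bool" where
  "admissible n \<sigma> \<tau> \<longleftrightarrow>
     (\<exists>h1 h2. anchored_unimodal h1 \<and> anchored_unimodal h2 \<and>
        (\<exists>x\<in>{0..1}. periodic_on_I1 h1 h2 x n \<sigma> \<tau>))"


subsection \<open>Bones\<close>

definition left_bone :: "nat \<Rightarrow> (nat \<Rightarrow> nat) \<Rightarrow> (nat \<Rightarrow> nat) \<Rightarrow> (real \<times> real) set" where
  "left_bone n \<sigma> \<tau> = {(v, w) \<in> param_space. periodic_on_I1 (q v) (q w) (1/2) n \<sigma> \<tau>}"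

definition right_bone :: "nat \<Rightarrow> (nat \<Rightarrow> nat) \<Rightarrow> (nat \<Rightarrow> nat) \<Rightarrow> (real \<times> real) set" where
  "right_bone n \<sigma> \<tau> = {(v, w) \<in> param_space. periodic_on_I2 (q v) (q w) (1/2) n \<sigma> \<tau>}"

datatype side = LeftSide | RightSide

fun bone :: "side \<Rightarrow> nat \<Rightarrow> (nat \<Rightarrow> nat) \<Rightarrow> (nat \<Rightarrow> nat) \<Rightarrow> (real \<times> real) set" where
  "bone LeftSide n \<sigma> \<tau> = left_bone n \<sigma> \<tau>"
| "bone RightSide n \<sigma> \<tau> = right_bone n \<sigma> \<tau>"


subsection \<open>Embedded \<open>C\<^sup>1\<close> curves and transversality\<close>

text \<open>
  A regular \<open>C\<^sup>1\<close> parametrization \<open>c\<close>, with velocity \<open>c'\<close>, of a relative neighbourhood of the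
  point \<open>p = c 0\<close> in \<open>B\<close>. The homeomorphism onto \<open>B \<inter> U\<close> makes this an embedded arc, ruling out
  self-crossings. The domain \<open>J\<close> will be \<open>{-1<..<1}\<close> near an inner point of the curve and
  \<open>{0..<1}\<close> (with one-sided derivative at 0) near an endpoint.
\<close>

definition C1_chart ::
  "real set \<Rightarrow> 'a::real_normed_vector set \<Rightarrow> 'a \<Rightarrow> (real \<Rightarrow> 'a) \<Rightarrow> (real \<Rightarrow> 'a) \<Rightarrow> bool" where
  "C1_chart J B p c c' \<longleftrightarrow>
     c 0 = p \<and>
     (\<forall>t\<in>J. (c has_vector_derivative c' t) (at t within J) \<and> c' t \<noteq> 0) \<and>
     continuous_on J c' \<and>
     (\<exists>U g. open U \<and> homeomorphism J (B \<inter> U) c g)"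

text \<open>
  One-dimensional embedded \<open>C\<^sup>1\<close> submanifold of the region \<open>P\<close>, whose endpoints, if any, lie on
  the boundary of \<open>P\<close>. Endpoints do occur for bones: the left bone with \<open>n = 1\<close> is the arc
  \<open>8 v w (1 - v) = 1\<close>, which ends at two points of the edge \<open>w = 1\<close>. Connectedness is not part of
  the notion.
\<close>

definition C1_curve_in :: "'a::real_normed_vector set \<Rightarrow> 'a set \<Rightarrow> bool" where
  "C1_curve_in P B \<longleftrightarrow>
     B \<subseteq> P \<and>
     (\<forall>p\<in>B. (\<exists>c c'. C1_chart {-1<..<1} B p c c') \<or>
            (p \<in> frontier P \<and> (\<exists>c c'. C1_chart {0..<1} B p c c')))"

definition tangent_line :: "'a::real_normed_vector set \<Rightarrow> 'a \<Rightarrow> 'a set" where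
  "tangent_line B p =
     {a *\<^sub>R c' 0 | a c c'. C1_chart {-1<..<1} B p c c' \<or> C1_chart {0..<1} B p c c'}"

definition intersect_transversally ::
  "'a::real_normed_vector set \<Rightarrow> 'a set \<Rightarrow> bool" where
  "intersect_transversally B B' \<longleftrightarrow>
     (\<forall>p\<in>B \<inter> B'. {u + u' | u u'. u \<in> tangent_line B p \<and> u' \<in> tangent_line B' p} = UNIV)"

end

theory Submission
  imports Defs "HOL-Real_Asymp.Real_Asymp"
begin

text \<open>
  Let \<open>F(v, w) = (q\<^sub>w \<circ> q\<^sub>v)\<^sup>n(1/2) - 1/2\<close>. Near one of its points a left bone is the zero set of \<open>F\<close> in
  the parameter square, so everything reduces to the gradient of \<open>F\<close>: it must not vanish, it must
  be independent of the gradient of the corresponding function of a right bone, and \<open>F\<^sub>v \<noteq> 0\<close> where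
  the left bone meets the edge \<open>w = 1\<close>. The right bones are the mirror images of the left ones.

  Each of these claims follows from an argument of Thurston and Epstein. The transfer operator
  \<open>Q \<mapsto> \<Sum> Q(x) / f'(x)\<^sup>2\<close> (sum over the preimages \<open>x\<close> under \<open>f\<close>) maps \<open>1/(x - p)\<close> to
  \<open>(1/(y - f(p)) - 1/(y - f(1/2))) / f'(p)\<close>. If a claim fails, the derivatives along the
  critical orbit are the residues of a pair of rational functions with simple poles that the
  transfer operators of \<open>q\<^sub>v\<close> and \<open>q\<^sub>w\<close> interchange. But these operators do not increase
  the area integral of \<open>|Q|\<close>: the integral of the image over a large disc is at most that of \<open>Q\<close> over
  the preimage of the disc, which lies in a smaller disc. Hence the pair vanishes on an annulus,
  and so identically, although one of its residues is nonzero.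
\<close>

subsection \<open>Contraction of the area norm\<close>

text \<open>The integrals live on \<open>real^2\<close>, where a change of variables brings in the
  determinant of a matrix; complex arithmetic enters through \<open>cplx\<close>.\<close>

definition cplx :: "real^2 \<Rightarrow> complex" where
  "cplx x = Complex (x $ 1) (x $ 2)"

definition uncplx :: "complex \<Rightarrow> real^2" where
  "uncplx z = vector [Re z, Im z]"

lemma cplx_uncplx [simp]: "cplx (uncplx z) = z" "uncplx (cplx x) = x"
  by (simp_all add: cplx_def uncplx_def vec_eq_iff forall_2)

lemma norm_cplx [simp]: "norm (cplx x) = norm x"
  by (simp add: cplx_def norm_vec_def L2_set_def sum_2 cmod_def)

lemma cplx_minus [simp]: "cplx (- x) = - cplx x"
  by (simp add: cplx_def complex_eq_iff)

lemma linear_cplx: "linear cplx"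
  by (rule linearI) (simp_all add: cplx_def complex_eq_iff)

lemma continuous_on_cplx [continuous_intros]:
  "continuous_on S f \<Longrightarrow> continuous_on S (\<lambda>x. cplx (f x))"
  using linear_cplx by (intro bounded_linear.continuous_on[of cplx]) (simp add: linear_conv_bounded_linear)

lemma linear_uncplx: "linear uncplx"
  by (rule linearI) (simp_all add: uncplx_def vec_eq_iff forall_2)

text \<open>With \<open>x = 1/2 + z\<close>, the map \<open>q\<^sub>v\<close> becomes \<open>sqmap (v - 1/2) (- 4 * v)\<close>. The right half plane without
  the real axis is a fundamental domain for \<open>z \<mapsto> -z\<close> that a square map sends onto the plane without
  the real axis, so the integrals below may ignore the real axis, where all poles lie.\<close>

definition sqmap :: "real \<Rightarrow> real \<Rightarrow> complex \<Rightarrow> complex" where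
  "sqmap a c z = of_real a + of_real c * z\<^sup>2"

lemma sqmap_surj:
  assumes "c \<noteq> 0" "Im u \<noteq> 0"
  obtains z where "Re z > 0" "Im z \<noteq> 0" "sqmap a c z = u"
proof
  let ?z = "csqrt ((u - of_real a) / of_real c)"
  have s: "?z\<^sup>2 = (u - of_real a) / of_real c" by simp
  have i: "Im (?z\<^sup>2) \<noteq> 0" using assms unfolding s by (simp add: Im_divide_of_real)
  show "sqmap a c ?z = u" using assms(1) by (simp only: sqmap_def s) (simp add: field_simps)
  have "Re ?z \<noteq> 0" "Im ?z \<noteq> 0"
    using i by (auto simp: power2_eq_square simp del: power2_csqrt csqrt.simps)
  then show "Re ?z > 0" "Im ?z \<noteq> 0" using csqrt_principal[of "(u - of_real a) / of_real c"]
    by (auto simp del: csqrt.simps)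
qed

lemma has_derivative_sqmap_real2:
  "((\<lambda>x. uncplx (sqmap a c (cplx x))) has_derivative (\<lambda>h. uncplx (of_real (2 * c) * cplx x * cplx h))) (at x within S)"
proof -
  have "((\<lambda>x. sqmap a c (cplx x)) has_derivative (\<lambda>h. of_real (2 * c) * cplx x * cplx h)) (at x within S)"
    unfolding sqmap_def
    by (rule derivative_eq_intros linear_imp_has_derivative[OF linear_cplx] refl | simp add: mult_ac)+
  from has_derivative_compose[OF this linear_imp_has_derivative[OF linear_uncplx]]
  show ?thesis .
qed

text \<open>Multiplication by \<open>u\<close> is a rotation combined with a scaling by the modulus
  of \<open>u\<close>.\<close>

lemma det_cplx_mult:
  "\<bar>det (matrix (\<lambda>h. uncplx (u * cplx h)))\<bar> = (norm u)\<^sup>2"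
  by (simp add: det_2 matrix_def uncplx_def cplx_def axis_def cmod_power2 flip: power2_eq_square)

definition slit_ball :: "real \<Rightarrow> (real^2) set" where
  "slit_ball R = {x. norm x < R \<and> x $ 2 \<noteq> 0}"

definition slit_halfplane :: "(real^2) set" where
  "slit_halfplane = {x. 0 < x $ 1 \<and> x $ 2 \<noteq> 0}"

lemma open_slit_halfplane: "open slit_halfplane"
  unfolding slit_halfplane_def
  by (intro open_Collect_conj open_Collect_less open_Collect_neq continuous_intros)

lemma open_slit_ball: "open (slit_ball R)"
  unfolding slit_ball_def
  by (intro open_Collect_conj open_Collect_less open_Collect_neq continuous_intros)

lemma Re_cplx [simp]: "Re (cplx x) = x $ 1" and Im_cplx [simp]: "Im (cplx x) = x $ 2"
  by (simp_all add: cplx_def)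

lemma uncplx_nth [simp]: "uncplx z $ 1 = Re z" "uncplx z $ 2 = Im z"
  by (simp_all add: uncplx_def)

lemma norm_uncplx [simp]: "norm (uncplx z) = norm z"
  using norm_cplx[of "uncplx z"] by simp

text \<open>The substitution \<open>u = p + z\<^sup>2\<close> cancels the singularity.\<close>

lemma absolutely_integrable_pole:
  "(\<lambda>x. 1 / norm (cplx x - of_real p)) absolutely_integrable_on slit_ball R"
proof -
  define r where "r = sqrt (max 0 R + \<bar>p\<bar>) + 1"
  define S where "S = slit_halfplane \<inter> ball 0 r"
  let ?g = "\<lambda>x. uncplx (sqmap p 1 (cplx x))"
  have S: "S \<in> lmeasurable"
    unfolding S_def by (intro lmeasurable_open bounded_Int open_Int open_slit_halfplane) auto
  \<comment> \<open>The Jacobian is 4|z|^2 and the pulled back integrand is 1/|z|^2.\<close>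
  have "(\<lambda>x. 4 :: real) absolutely_integrable_on S"
    using S by (intro absolutely_integrable_on_const)
  then have "(\<lambda>x. \<bar>det (matrix (\<lambda>h. uncplx (of_real (2 * 1) * cplx x * cplx h)))\<bar> *
      (1 / norm (cplx (?g x) - of_real p))) absolutely_integrable_on S"
    by (rule absolutely_integrable_spike[OF _ negligible_empty])
       (auto simp: det_cplx_mult sqmap_def S_def slit_halfplane_def norm_mult norm_power power_mult_distrib complex_eq_iff
         simp flip: norm_cplx)
  then have "(\<lambda>x. 1 / norm (cplx x - of_real p)) absolutely_integrable_on ?g ` S"
    by (rule absolutely_integrable_on_image_real[OF has_derivative_sqmap_real2])
  then show ?thesis
  proof (rule set_integrable_subset)
    show "slit_ball R \<subseteq> ?g ` S"
    proof
      fix x assume x: "x \<in> slit_ball R"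
      then obtain z where z: "Re z > 0" "Im z \<noteq> 0" "sqmap p 1 z = cplx x"
        using sqmap_surj[of 1 "cplx x" p] by (auto simp: slit_ball_def)
      have "norm (z\<^sup>2) = norm (cplx x - of_real p)" using z(3) by (simp add: sqmap_def algebra_simps flip: z(3))
      also have "\<dots> \<le> norm x + \<bar>p\<bar>" using norm_triangle_ineq4[of "cplx x" "of_real p"] by simp
      also have "\<dots> \<le> max 0 R + \<bar>p\<bar>" using x by (auto simp: slit_ball_def)
      finally have "norm z \<le> sqrt (max 0 R + \<bar>p\<bar>)" by (intro real_le_rsqrt) (simp add: norm_power)
      then have "norm z < r" by (simp add: r_def)
      then show "x \<in> ?g ` S" using z
        by (intro image_eqI[of _ _ "uncplx z"]) (auto simp: S_def slit_halfplane_def)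
    qed
  qed (simp add: open_slit_ball lebesgue_openin)
qed

section \<open>Sums of simple poles on the real axis and their area integrals\<close>

definition poles :: "real set \<Rightarrow> (real \<Rightarrow> real) \<Rightarrow> complex \<Rightarrow> complex" where
  "poles S \<alpha> z = (\<Sum>p\<in>S. of_real (\<alpha> p) / (z - of_real p))"

lemma continuous_on_poles: "continuous_on (slit_ball R) (\<lambda>x. poles S \<alpha> (cplx x))"
proof -
  have "cplx x \<noteq> of_real p" if "x \<in> slit_ball R" for x p
    using that by (auto simp: slit_ball_def complex_eq_iff)
  then show ?thesis unfolding poles_def by (intro continuous_intros) auto
qed

lemma absolutely_integrable_poles:
  assumes "finite S"
  shows "(\<lambda>x. norm (poles S \<alpha> (cplx x))) absolutely_integrable_on slit_ball R"
proof (rule measurable_bounded_by_integrable_imp_absolutely_integrable)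
  show "slit_ball R \<in> sets lebesgue" by (simp add: open_slit_ball lebesgue_openin)
  show "(\<lambda>x. norm (poles S \<alpha> (cplx x))) \<in> borel_measurable (lebesgue_on (slit_ball R))"
    by (intro continuous_imp_measurable_on_sets_lebesgue continuous_intros continuous_on_poles)
       (simp add: open_slit_ball lebesgue_openin)
  show "(\<lambda>x. \<Sum>p\<in>S. \<bar>\<alpha> p\<bar> * (1 / norm (cplx x - of_real p))) integrable_on slit_ball R"
    using absolutely_integrable_pole
    by (intro integrable_sum assms integrable_on_mult_right) (auto simp: absolutely_integrable_on_def)
  show "norm (norm (poles S \<alpha> (cplx x))) \<le> (\<Sum>p\<in>S. \<bar>\<alpha> p\<bar> * (1 / norm (cplx x - of_real p)))" for x
    using norm_sum[of "\<lambda>p. of_real (\<alpha> p) / (cplx x - of_real p)" S]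
    by (simp add: poles_def norm_divide)
qed

text \<open>Hypothesis \<open>eq\<close> makes the residues \<beta> the transfer of the residues
  \<alpha>, with denominators cleared by the square of the derivative 2cz. Substitution turns the
  left integral into that of the sum over both preimages, and the triangle inequality splits it into
  integrals over the two disjoint halves of the preimage of the disc.\<close>

lemma integral_poles_le:
  assumes S: "finite S" and c: "c \<noteq> 0"
    and eq: "\<And>z. Re z \<noteq> 0 \<Longrightarrow> Im z \<noteq> 0 \<Longrightarrow>
      poles S \<beta> (sqmap a c z) * (of_real (2 * c) * z)\<^sup>2 = poles S \<alpha> z + poles S \<alpha> (- z)"
    and R: "\<And>z. norm (sqmap a c z) < R \<Longrightarrow> norm z < R'"
  shows "integral (slit_ball R) (\<lambda>x. norm (poles S \<beta> (cplx x)))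
    \<le> integral (slit_ball R') (\<lambda>x. norm (poles S \<alpha> (cplx x)))"
proof -
  let ?A = "\<lambda>x. norm (poles S \<alpha> (cplx x))" and ?B = "\<lambda>x. norm (poles S \<beta> (cplx x))"
  let ?g = "\<lambda>x. uncplx (sqmap a c (cplx x))"
  let ?d = "\<lambda>x. \<bar>det (matrix (\<lambda>h. uncplx (of_real (2 * c) * cplx x * cplx h)))\<bar>"
  \<comment> \<open>The half of the preimage in the fundamental domain; its reflection is the other
    half.\<close>
  define H where "H = {x \<in> slit_halfplane. norm (?g x) < R}"
  have "open (slit_halfplane \<inter> {x. norm (?g x) < R})" unfolding norm_uncplx sqmap_def
    by (intro open_Int open_slit_halfplane open_Collect_less continuous_intros)
  also have "slit_halfplane \<inter> {x. norm (?g x) < R} = H" by (auto simp: H_def)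
  finally have oH: "open H" .
  have omH: "open (uminus ` H)" using oH open_negations by blast
  have HR: "H \<subseteq> slit_ball R'" using R[of "cplx _"] by (auto simp: H_def slit_ball_def slit_halfplane_def)
  have mHR: "uminus ` H \<subseteq> slit_ball R'" using HR by (auto simp: slit_ball_def)
  have int: "?A integrable_on T" if "open T" "T \<subseteq> slit_ball R'" for T
    using set_integrable_subset[OF absolutely_integrable_poles[OF S, of R' \<alpha>] _ that(2)] that(1)
    by (auto simp: absolutely_integrable_on_def lebesgue_openin)
  have abs: "?A absolutely_integrable_on T" if "open T" "T \<subseteq> slit_ball R'" for T
    using set_integrable_subset[OF absolutely_integrable_poles[OF S, of R' \<alpha>] _ that(2)] that(1)
    by (auto simp: lebesgue_openin)
  have img: "?g ` H = slit_ball R"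
  proof
    show "?g ` H \<subseteq> slit_ball R" using c
      by (auto simp: H_def slit_ball_def slit_halfplane_def sqmap_def Im_power2)
    show "slit_ball R \<subseteq> ?g ` H"
    proof
      fix x assume x: "x \<in> slit_ball R"
      then obtain z where z: "Re z > 0" "Im z \<noteq> 0" "sqmap a c z = cplx x"
        using sqmap_surj[OF c, of "cplx x" a] by (auto simp: slit_ball_def)
      then show "x \<in> ?g ` H" using x
        by (intro image_eqI[of _ _ "uncplx z"]) (auto simp: H_def slit_halfplane_def slit_ball_def)
    qed
  qed
  have *: "?d x * ?B (?g x) = norm (poles S \<alpha> (cplx x) + poles S \<alpha> (cplx (-x)))" if "x \<in> H" for x
  proof -
    \<comment> \<open>The Jacobian is the modulus of the squared derivative in
      \<open>eq\<close>.\<close>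
    have "?d x * ?B (?g x) = norm (poles S \<beta> (sqmap a c (cplx x)) * (of_real (2 * c) * cplx x)\<^sup>2)"
      unfolding det_cplx_mult by (simp add: norm_mult norm_power)
    then show ?thesis
      using that by (subst (asm) eq) (auto simp: H_def slit_halfplane_def)
  qed
  have det1: "\<bar>det (matrix (uminus :: real^2 \<Rightarrow> real^2))\<bar> = 1"
    by (simp add: det_2 matrix_def axis_def)
  have Arefl: "(\<lambda>x. ?A (-x)) absolutely_integrable_on H"
  proof -
    have "(\<lambda>x. ?A (-x)) absolutely_integrable_on uminus ` uminus ` H"
      by (rule absolutely_integrable_on_image_real[where g' = "\<lambda>_. uminus"])
         (use abs[OF omH mHR] in \<open>auto intro!: derivative_eq_intros simp: det1\<close>)
    then show ?thesis by (simp add: image_image)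
  qed
  then have Arefl': "(\<lambda>x. ?A (-x)) integrable_on H" by (simp add: absolutely_integrable_on_def)
  have le: "integral H (\<lambda>x. ?A (-x)) \<le> integral (uminus ` H) ?A"
  proof -
    have "integral (uminus ` uminus ` H) (\<lambda>x. ?A (-x))
      \<le> integral (uminus ` H) (\<lambda>x. \<bar>det (matrix (uminus :: real^2 \<Rightarrow> real^2))\<bar> * ?A (- (- x)))"
      using int[OF omH mHR]
      by (intro integral_on_image_ubound[where g' = "\<lambda>_. uminus"])
         (auto intro!: derivative_eq_intros simp: det1)
    then show ?thesis by (simp add: image_image det1)
  qed
  have intsum: "(\<lambda>x. norm (poles S \<alpha> (cplx x) + poles S \<alpha> (cplx (-x)))) integrable_on H"
  proof (rule measurable_bounded_by_integrable_imp_integrable)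
    show "(\<lambda>x. norm (poles S \<alpha> (cplx x) + poles S \<alpha> (cplx (- x)))) \<in> borel_measurable (lebesgue_on H)"
    proof (intro continuous_imp_measurable_on_sets_lebesgue continuous_on_norm continuous_on_add)
      show "continuous_on H (\<lambda>x. poles S \<alpha> (cplx x))"
        using continuous_on_subset[OF continuous_on_poles HR] .
      show "continuous_on H (\<lambda>x. poles S \<alpha> (cplx (- x)))"
        using continuous_on_compose2[OF continuous_on_poles continuous_on_minus[OF continuous_on_id] mHR] by simp
    qed (simp add: oH lebesgue_openin)
    show "(\<lambda>x. ?A x + ?A (-x)) integrable_on H"
      by (intro integrable_add int oH HR Arefl')
  qed (auto intro: norm_triangle_ineq simp: oH lebesgue_openin)
  have "integral (slit_ball R) ?B \<le> integral H (\<lambda>x. ?d x * ?B (?g x))"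
    unfolding img[symmetric]
  proof (rule integral_on_image_ubound[OF _ has_derivative_sqmap_real2])
    show "(\<lambda>x. ?d x * ?B (?g x)) integrable_on H"
      using intsum by (rule integrable_eq) (rule *[symmetric])
  qed auto
  also have "\<dots> = integral H (\<lambda>x. norm (poles S \<alpha> (cplx x) + poles S \<alpha> (cplx (-x))))"
    by (intro integral_cong *)
  also have "\<dots> \<le> integral H (\<lambda>x. ?A x + ?A (-x))"
    by (intro integral_le intsum integrable_add int oH HR Arefl' norm_triangle_ineq)
  also have "\<dots> = integral H ?A + integral H (\<lambda>x. ?A (-x))"
    by (intro integral_add int oH HR Arefl')
  also have "\<dots> \<le> integral H ?A + integral (uminus ` H) ?A" using le by simp
  also have "\<dots> = integral (H \<union> uminus ` H) ?A"
  proof -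
    have "H \<inter> uminus ` H = {}" by (auto simp: H_def slit_halfplane_def)
    then show ?thesis by (intro integral_Un[symmetric] int oH omH HR mHR) simp
  qed
  also have "\<dots> \<le> integral (slit_ball R') ?A"
    using HR mHR by (intro integral_subset_le int open_Un oH omH open_slit_ball) auto
  finally show ?thesis .
qed


text \<open>Quadratic growth beats the identity. The gap 1 leaves an annulus between the two radii,
  on which the pole sums will be shown to vanish.\<close>

lemma sqmap_escape:
  assumes "c \<noteq> 0"
  shows "eventually (\<lambda>R. \<forall>z. norm (sqmap a c z) < R \<longrightarrow> norm z < R - 1) at_top"
proof -
  have "eventually (\<lambda>R. R \<le> \<bar>c\<bar> * (R - 1)\<^sup>2 - \<bar>a\<bar>) at_top" using assms by real_asymp
  then show ?thesis using eventually_ge_at_top[of 1]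
  proof eventually_elim
    case (elim R)
    show ?case
    proof (intro allI impI, rule ccontr)
      fix z assume z: "norm (sqmap a c z) < R" "\<not> norm z < R - 1"
      have "\<bar>c\<bar> * (R - 1)\<^sup>2 \<le> \<bar>c\<bar> * (norm z)\<^sup>2"
        using z elim by (intro mult_left_mono power_mono) auto
      also have "\<dots> = norm (of_real c * z\<^sup>2)" by (simp add: norm_mult norm_power)
      also have "\<dots> \<le> norm (sqmap a c z) + \<bar>a\<bar>"
        using norm_triangle_ineq4[of "sqmap a c z" "of_real a"] by (simp add: sqmap_def)
      finally show False using elim z by simp
    qed
  qed
qed

text \<open>Clearing denominators gives a polynomial with infinitely many roots, hence zero. At
  \<open>p\<close> every summand except that of \<open>p\<close> vanishes, which isolates the
  residue.\<close>

lemma poles_eq_0_imp: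
  fixes \<alpha> :: "real \<Rightarrow> real"
  assumes "finite S" "infinite {z. poles S \<alpha> z = 0}" "p \<in> S"
  shows "\<alpha> p = 0"
proof -
  define f where "f = (\<Sum>r\<in>S. smult (of_real (\<alpha> r)) (\<Prod>s\<in>S - {r}. [:- of_real s, 1:]) :: complex poly)"
  have f: "poly f z = (\<Sum>r\<in>S. of_real (\<alpha> r) * (\<Prod>s\<in>S - {r}. z - of_real s))" for z
    by (simp add: f_def poly_sum poly_prod)
  \<comment> \<open>Points of \<open>S\<close> are excluded because division by zero hides the pole
    there.\<close>
  have "poly f z = 0" if "poles S \<alpha> z = 0" "z \<notin> of_real ` S" for z
  proof -
    have "poly f z = (\<Sum>r\<in>S. of_real (\<alpha> r) / (z - of_real r) * (\<Prod>s\<in>S. z - of_real s))"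
      unfolding f
    proof (rule sum.cong[OF refl])
      fix r assume "r \<in> S"
      then show "of_real (\<alpha> r) * (\<Prod>s\<in>S - {r}. z - of_real s) = of_real (\<alpha> r) / (z - of_real r) * (\<Prod>s\<in>S. z - of_real s)"
        using that(2) prod.remove[OF assms(1) \<open>r \<in> S\<close>, of "\<lambda>s. z - of_real s"] by auto
    qed
    also have "\<dots> = poles S \<alpha> z * (\<Prod>s\<in>S. z - of_real s)" by (simp add: poles_def sum_distrib_right)
    finally show ?thesis using that by simp
  qed
  then have "{z. poles S \<alpha> z = 0} - of_real ` S \<subseteq> {z. poly f z = 0}" by auto
  moreover have "infinite ({z. poles S \<alpha> z = 0} - of_real ` S)" using assms by auto
  ultimately have "f = 0" using poly_roots_finite[of f] infinite_super by blast
  then have "0 = poly f (of_real p)" by simp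
  also have "\<dots> = of_real (\<alpha> p) * (\<Prod>s\<in>S - {p}. of_real p - of_real s)"
    unfolding f using assms by (subst sum.remove[of _ p]) (auto intro!: sum.neutral prod_zero)
  finally show ?thesis using assms(1) by auto
qed

text \<open>No mass is left on the annulus between the radii, so the continuous integrand vanishes
  there and the pole sum has infinitely many zeros.\<close>

lemma poles_eq_0_if_integral_eq:
  fixes \<alpha> :: "real \<Rightarrow> real"
  assumes S: "finite S" and R: "R < R'"
    and eq: "integral (slit_ball R) (\<lambda>x. norm (poles S \<alpha> (cplx x))) = integral (slit_ball R') (\<lambda>x. norm (poles S \<alpha> (cplx x)))"
    and "0 < R'" "p \<in> S"
  shows "\<alpha> p = 0"
proof -
  let ?A = "\<lambda>x. norm (poles S \<alpha> (cplx x))"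
  define U where "U = slit_ball R' - cball 0 R"
  have oU: "open U" by (simp add: U_def open_Diff open_slit_ball)
  have int: "?A integrable_on T" if "open T" "T \<subseteq> slit_ball R'" for T
    using set_integrable_subset[OF absolutely_integrable_poles[OF S, of R' \<alpha>] _ that(2)] that(1)
    by (auto simp: absolutely_integrable_on_def lebesgue_openin)
  have "slit_ball R \<subseteq> slit_ball R'" using R by (auto simp: slit_ball_def)
  then have "integral (slit_ball R) ?A + integral U ?A = integral (slit_ball R \<union> U) ?A"
  proof (intro integral_Un[symmetric] int open_slit_ball oU)
    have "slit_ball R \<inter> U = {}" by (auto simp: U_def slit_ball_def)
    then show "negligible (slit_ball R \<inter> U)" by simp
  qed (auto simp: U_def)
  also have "\<dots> \<le> integral (slit_ball R') ?A"
    using R by (intro integral_subset_le int open_slit_ball oU open_Un) (auto simp: U_def slit_ball_def)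
  finally have "integral U ?A \<le> 0" using eq by simp
  have zero: "?A x = 0" if x: "x \<in> U" for x
  proof -
    obtain a b where ab: "cbox a b \<subseteq> U" "x \<in> box a b"
      using open_contains_cbox[OF oU x] by metis
    have cont: "continuous_on (cbox a b) ?A"
      using ab by (intro continuous_on_norm continuous_on_subset[OF continuous_on_poles[of R']]) (auto simp: U_def)
    have "integral (cbox a b) ?A \<le> integral U ?A"
      using ab cont by (intro integral_subset_le integrable_continuous int oU) (auto simp: U_def)
    moreover have "integral (cbox a b) ?A \<ge> 0" by (intro integral_nonneg integrable_continuous cont) auto
    ultimately have "integral (cbox a b) ?A = 0" using \<open>integral U ?A \<le> 0\<close> by simp
    then have "(?A has_integral 0) (cbox a b)"
      using integrable_integral[OF integrable_continuous[OF cont]] by simp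
    then show ?thesis using ab subsetD[OF box_subset_cbox ab(2)] by (intro has_integral_0_cbox_imp_0[OF cont]) auto
  qed
  \<comment> \<open>As \<open>R\<close> may be negative, the maximum ensures a positive radius; the
    point of modulus \<open>m\<close> on the imaginary axis avoids both the slit and the inner
    disc.\<close>
  define m where "m = (max R 0 + R') / 2"
  have m: "0 < m" "R < m" "m < R'" using R \<open>0 < R'\<close> by (auto simp: m_def)
  obtain x where x: "x \<in> U"
  proof
    show "uncplx (of_real m * \<i>) \<in> U" using m by (auto simp: U_def slit_ball_def norm_mult)
  qed
  have "infinite U" using oU x finite_imp_not_open by blast
  then have "infinite (cplx ` U)" by (subst finite_image_iff) (auto intro: inj_on_inverseI[of _ uncplx])
  moreover have "cplx ` U \<subseteq> {z. poles S \<alpha> z = 0}" using zero by auto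
  ultimately show ?thesis using assms poles_eq_0_imp infinite_super by blast
qed

text \<open>Passing from \<alpha> to \<beta> and back bounds the integral over radius
  \<open>R\<close> by the one over radius \<open>R - 1\<close>. Monotonicity gives the converse, so
  the two integrals agree.\<close>

lemma poles_rigidity:
  assumes S: "finite S" and c: "c \<noteq> 0" "d \<noteq> 0"
    and ab: "\<And>z. Re z \<noteq> 0 \<Longrightarrow> Im z \<noteq> 0 \<Longrightarrow>
      poles S \<beta> (sqmap a c z) * (of_real (2 * c) * z)\<^sup>2 = poles S \<alpha> z + poles S \<alpha> (- z)"
    and ba: "\<And>z. Re z \<noteq> 0 \<Longrightarrow> Im z \<noteq> 0 \<Longrightarrow>
      poles S \<alpha> (sqmap b d z) * (of_real (2 * d) * z)\<^sup>2 = poles S \<beta> z + poles S \<beta> (- z)"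
    and p: "p \<in> S"
  shows "\<alpha> p = 0"
proof -
  have "eventually (\<lambda>R. R - 1 > 0 \<and> (\<forall>z. norm (sqmap a c z) < R \<longrightarrow> norm z < R - 1)
      \<and> (\<forall>z. norm (sqmap b d z) < R \<longrightarrow> norm z < R - 1)) at_top"
    by (intro eventually_conj sqmap_escape c) real_asymp
  then obtain R where R: "R - 1 > 0" "\<And>z. norm (sqmap a c z) < R \<Longrightarrow> norm z < R - 1"
    "\<And>z. norm (sqmap b d z) < R \<Longrightarrow> norm z < R - 1"
    using eventually_happens'[OF trivial_limit_at_top_linorder] by blast
  let ?I = "\<lambda>\<alpha> R. integral (slit_ball R) (\<lambda>x. norm (poles S \<alpha> (cplx x)))"
  have "?I \<alpha> R \<le> ?I \<beta> (R - 1)" by (rule integral_poles_le[OF S c(2) ba R(3)])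
  also have "?I \<beta> (R - 1) \<le> ?I \<beta> R"
    by (intro integral_subset_le)
       (use absolutely_integrable_poles[OF S] in \<open>auto simp: slit_ball_def absolutely_integrable_on_def\<close>)
  also have "?I \<beta> R \<le> ?I \<alpha> (R - 1)" by (rule integral_poles_le[OF S c(1) ab R(2)])
  finally have "?I \<alpha> R \<le> ?I \<alpha> (R - 1)" .
  moreover have "?I \<alpha> (R - 1) \<le> ?I \<alpha> R"
    by (intro integral_subset_le)
       (use absolutely_integrable_poles[OF S] in \<open>auto simp: slit_ball_def absolutely_integrable_on_def\<close>)
  ultimately show ?thesis
    using R(1) by (intro poles_eq_0_if_integral_eq[OF S, of "R - 1" R \<alpha>] p) auto
qed


subsection \<open>Derivatives along the critical orbit\<close>

lemma poles_linear:
  "poles S (\<lambda>p. a * \<alpha> p + b * \<beta> p) z = of_real a * poles S \<alpha> z + of_real b * poles S \<beta> z"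
  by (simp add: poles_def sum.distrib sum_distrib_left add_divide_distrib)

text \<open>Orbit points may coincide, so the residue at \<open>r\<close> collects all indices
  \<open>i\<close> with \<open>p i = r\<close>.\<close>

definition point_sum :: "nat \<Rightarrow> (nat \<Rightarrow> real) \<Rightarrow> (nat \<Rightarrow> real) \<Rightarrow> real \<Rightarrow> real" where
  "point_sum n c p r = (\<Sum>i<n. c i * of_bool (p i = r))"

lemma poles_point_sum:
  assumes "finite S" "p ` {..<n} \<subseteq> S"
  shows "poles S (point_sum n c p) z = (\<Sum>i<n. of_real (c i) / (z - of_real (p i)))"
proof -
  have "poles S (point_sum n c p) z = (\<Sum>r\<in>S. \<Sum>i<n. if r = p i then of_real (c i) / (z - of_real r) else 0)"
    unfolding poles_def point_sum_def of_real_sum sum_divide_distrib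
    by (intro sum.cong refl) auto
  also have "\<dots> = (\<Sum>i<n. \<Sum>r\<in>S. if r = p i then of_real (c i) / (z - of_real r) else 0)"
    by (rule sum.swap)
  also have "\<dots> = (\<Sum>i<n. of_real (c i) / (z - of_real (p i)))"
    using assms by (intro sum.cong refl) (auto simp: sum.delta)
  finally show ?thesis .
qed

text \<open>Partial fractions for the transfer of a pole at \<open>P\<close> under f(z) = a + c z^2.
  With the factor f'(P) = 2cP kept on the left, the identity also covers a pole at the critical
  point, where both sides are 0.\<close>

lemma push_pole:
  fixes c P a :: real and z :: complex
  assumes "c \<noteq> 0" "Re z \<noteq> 0" "Im z \<noteq> 0"
  shows "of_real (2 * c * P * m) / (z - of_real P) + of_real (2 * c * P * m) / (- z - of_real P)
    = (of_real m / (sqmap a c z - of_real (a + c * P\<^sup>2)) - of_real m / (sqmap a c z - of_real a)) * (of_real (2 * c) * z)\<^sup>2"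
proof -
  have nz: "z - of_real P \<noteq> 0" "- z - of_real P \<noteq> 0" "z \<noteq> 0" "z + of_real P \<noteq> 0"
    using assms by (auto simp: complex_eq_iff)
  have c: "complex_of_real c \<noteq> 0" using assms by simp
  have 1: "sqmap a c z - of_real (a + c * P\<^sup>2) = of_real c * ((z - of_real P) * (z + of_real P))"
    by (simp add: sqmap_def algebra_simps power2_eq_square)
  have 2: "sqmap a c z - of_real a = of_real c * z\<^sup>2" by (simp add: sqmap_def)
  have 3: "- z - of_real P = - (z + of_real P)" by simp
  show ?thesis unfolding 1 2 3 using nz c
    by (simp add: divide_simps) (simp add: power2_eq_square algebra_simps)
qed

text \<open>The derivative of \<open>q v\<close>.\<close>

definition qd :: "real \<Rightarrow> real \<Rightarrow> real" where
  "qd v x = 4 * v * (1 - 2 * x)"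

definition orbit1 :: "real \<Rightarrow> real \<Rightarrow> nat \<Rightarrow> real" where
  "orbit1 v w k = ((q w \<circ> q v) ^^ k) (1/2)"

definition orbit2 :: "real \<Rightarrow> real \<Rightarrow> nat \<Rightarrow> real" where
  "orbit2 v w k = q v (orbit1 v w k)"

lemma orbit1_0 [simp]: "orbit1 v w 0 = 1/2" and orbit1_Suc: "orbit1 v w (Suc k) = q w (orbit2 v w k)"
  by (simp_all add: orbit1_def orbit2_def)

text \<open>The partial derivatives of \<open>orbit1\<close> in v and w, computed by the chain rule;
  \<open>q 1 x\<close> is the derivative of \<open>q v x\<close> in v.\<close>

primrec dv_orbit :: "real \<Rightarrow> real \<Rightarrow> nat \<Rightarrow> real" where
  "dv_orbit v w 0 = 0"
| "dv_orbit v w (Suc k) = qd w (orbit2 v w k) * (qd v (orbit1 v w k) * dv_orbit v w k + q 1 (orbit1 v w k))"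

primrec dw_orbit :: "real \<Rightarrow> real \<Rightarrow> nat \<Rightarrow> real" where
  "dw_orbit v w 0 = 0"
| "dw_orbit v w (Suc k) = qd w (orbit2 v w k) * (qd v (orbit1 v w k) * dw_orbit v w k) + q 1 (orbit2 v w k)"

text \<open>\<open>chain1 v w n k\<close> and \<open>chain2 v w n k\<close> are the derivatives of the return to the \<open>n\<close>-th point of the
  orbit in \<open>I\<^sub>1\<close>, from its \<open>k\<close>-th point in \<open>I\<^sub>1\<close> and in \<open>I\<^sub>2\<close>.\<close>

definition chain1 :: "real \<Rightarrow> real \<Rightarrow> nat \<Rightarrow> nat \<Rightarrow> real" where
  "chain1 v w n k = (\<Prod>j=k..<n. qd v (orbit1 v w j) * qd w (orbit2 v w j))"

definition chain2 :: "real \<Rightarrow> real \<Rightarrow> nat \<Rightarrow> nat \<Rightarrow> real" where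
  "chain2 v w n k = qd w (orbit2 v w k) * chain1 v w n (Suc k)"

lemma chain1_self [simp]: "chain1 v w n n = 1"
  by (simp add: chain1_def)

lemma chain1_eq_chain2: "k < n \<Longrightarrow> chain1 v w n k = qd v (orbit1 v w k) * chain2 v w n k"
  by (simp add: chain1_def chain2_def prod.atLeast_Suc_lessThan)

lemma chain1_Suc: "k \<le> n \<Longrightarrow> chain1 v w (Suc n) k = chain1 v w n k * (qd v (orbit1 v w n) * qd w (orbit2 v w n))"
  by (simp add: chain1_def)

lemma chain2_Suc: "k < n \<Longrightarrow> chain2 v w (Suc n) k = chain2 v w n k * (qd v (orbit1 v w n) * qd w (orbit2 v w n))"
  by (simp add: chain2_def chain1_Suc)

text \<open>Each use of \<open>q v\<close> contributes its own variation, transported to the end of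
  the orbit by \<open>chain2\<close>. The factor \<open>v\<close> turns the variation
  \<open>q 1 x\<close> into the orbit point \<open>q v x\<close> itself.\<close>

lemma dv_orbit_eq_sum: "v * dv_orbit v w n = (\<Sum>k<n. chain2 v w n k * orbit2 v w k)"
proof (induction n)
  case (Suc n)
  have "(\<Sum>k<Suc n. chain2 v w (Suc n) k * orbit2 v w k)
     = (\<Sum>k<n. (chain2 v w n k * orbit2 v w k) * (qd v (orbit1 v w n) * qd w (orbit2 v w n))) + chain2 v w (Suc n) n * orbit2 v w n"
    by (simp add: chain2_Suc mult_ac)
  also have "\<dots> = v * dv_orbit v w n * (qd v (orbit1 v w n) * qd w (orbit2 v w n)) + qd w (orbit2 v w n) * orbit2 v w n"
    by (simp add: Suc chain2_def flip: sum_distrib_right)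
  also have "\<dots> = v * dv_orbit v w (Suc n)"
    by (simp add: orbit2_def q_def algebra_simps)
  finally show ?case by simp
qed simp

lemma dw_orbit_eq_sum: "w * dw_orbit v w n = (\<Sum>k<n. chain1 v w n (Suc k) * orbit1 v w (Suc k))"
proof (induction n)
  case (Suc n)
  have "(\<Sum>k<Suc n. chain1 v w (Suc n) (Suc k) * orbit1 v w (Suc k))
     = (\<Sum>k<n. (chain1 v w n (Suc k) * orbit1 v w (Suc k)) * (qd v (orbit1 v w n) * qd w (orbit2 v w n))) + orbit1 v w (Suc n)"
    by (simp add: chain1_Suc mult_ac)
  also have "\<dots> = w * dw_orbit v w n * (qd v (orbit1 v w n) * qd w (orbit2 v w n)) + orbit1 v w (Suc n)"
    by (simp add: Suc flip: sum_distrib_right)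
  also have "\<dots> = w * dw_orbit v w (Suc n)"
    by (simp add: orbit1_Suc q_def algebra_simps)
  finally show ?case by simp
qed simp

text \<open>\<open>sum2\<close> and \<open>sum1\<close> are the derivatives of the n-th return when
  a constant is added to \<open>q v\<close> and to \<open>q w\<close>, respectively.\<close>

definition sum2 :: "real \<Rightarrow> real \<Rightarrow> nat \<Rightarrow> real" where
  "sum2 v w n = (\<Sum>k<n. chain2 v w n k)"

definition sum1 :: "real \<Rightarrow> real \<Rightarrow> nat \<Rightarrow> real" where
  "sum1 v w n = (\<Sum>k<n. chain1 v w n (Suc k))"

text \<open>Conjugation by scalings of \<open>I\<^sub>2\<close> and \<open>I\<^sub>1\<close> about the critical points does not change the period, so the
  corresponding deformations of the maps yield linear relations between the derivatives with respect
  to scaling and translation of the critical values.\<close>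

lemma rescale_I2: "v * dv_orbit v w n - 2 * w * dw_orbit v w n = sum2 v w n / 2 - 2 * w * sum1 v w n"
proof -
  have "v * dv_orbit v w n - sum2 v w n / 2 = (\<Sum>k<n. chain2 v w n k * (orbit2 v w k - 1/2))"
    by (simp add: dv_orbit_eq_sum sum2_def right_diff_distrib sum_subtractf sum_divide_distrib)
  \<comment> \<open>Since q_w(y) - w is homogeneous of degree 2 in y - 1/2, Euler's identity gives
    q_w'(y) (y - 1/2) = 2 (q_w(y) - w).\<close>
  also have "\<dots> = (\<Sum>k<n. 2 * (chain1 v w n (Suc k) * orbit1 v w (Suc k)) - 2 * w * chain1 v w n (Suc k))"
    by (intro sum.cong refl) (simp add: chain2_def qd_def orbit1_Suc q_def field_simps)
  also have "\<dots> = 2 * (w * dw_orbit v w n) - 2 * w * sum1 v w n"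
    by (simp only: sum_subtractf dw_orbit_eq_sum sum1_def flip: sum_distrib_left)
  finally show ?thesis by simp
qed

lemma rescale_I1:
  assumes "orbit1 v w n = 1/2"
  shows "w * dw_orbit v w n - 2 * v * dv_orbit v w n = sum1 v w n / 2 - 2 * v * sum2 v w n"
proof -
  let ?f = "\<lambda>k. chain1 v w n k * (orbit1 v w k - 1/2)"
  have "w * dw_orbit v w n - sum1 v w n / 2 = (\<Sum>k<n. ?f (Suc k))"
    by (simp add: dw_orbit_eq_sum sum1_def right_diff_distrib sum_subtractf sum_divide_distrib)
  \<comment> \<open>A cyclic shift of the index: the terms for 0 and for \<open>n\<close> both
    vanish, as the orbit is at 1/2 there.\<close>
  also have "\<dots> = (\<Sum>k<n. ?f k)"
    using sum.lessThan_Suc_shift[of ?f n] assms by simp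
  also have "\<dots> = (\<Sum>k<n. 2 * (chain2 v w n k * orbit2 v w k) - 2 * v * chain2 v w n k)"
    by (intro sum.cong refl) (simp add: chain1_eq_chain2 qd_def orbit2_def q_def field_simps)
  also have "\<dots> = 2 * (v * dv_orbit v w n) - 2 * v * sum2 v w n"
    by (simp only: sum_subtractf dv_orbit_eq_sum sum2_def flip: sum_distrib_left)
  finally show ?thesis by simp
qed

text \<open>Points are moved by 1/2 because \<open>sqmap\<close> has its critical point at 0. In
  \<open>I\<^sub>1\<close> the indices run from 1 to n: the returned critical point has residue 1,
  whereas the derivative transported from time 0 would be 0.\<close>

definition res1 :: "real \<Rightarrow> real \<Rightarrow> nat \<Rightarrow> real \<Rightarrow> real" where
  "res1 v w n = point_sum n (\<lambda>k. chain1 v w n (Suc k)) (\<lambda>k. orbit1 v w (Suc k) - 1/2)"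

definition res2 :: "real \<Rightarrow> real \<Rightarrow> nat \<Rightarrow> real \<Rightarrow> real" where
  "res2 v w n = point_sum n (\<lambda>k. chain2 v w n k) (\<lambda>k. orbit2 v w k - 1/2)"

abbreviation qc :: "real \<Rightarrow> complex \<Rightarrow> complex" where
  "qc v \<equiv> sqmap (v - 1/2) (- 4 * v)"

lemma push_pole_q:
  assumes "v \<noteq> 0" "Re z \<noteq> 0" "Im z \<noteq> 0"
  shows "of_real (qd v x * m) / (z - of_real (x - 1/2)) + of_real (qd v x * m) / (- z - of_real (x - 1/2))
    = (of_real m / (qc v z - of_real (q v x - 1/2)) - of_real m / (qc v z - of_real (v - 1/2)))
      * (of_real (2 * (- 4 * v)) * z)\<^sup>2"
proof -
  have 1: "2 * (- 4 * v) * (x - 1/2) = qd v x" by (simp add: qd_def algebra_simps)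
  have 2: "(v - 1/2) + (- 4 * v) * (x - 1/2)\<^sup>2 = q v x - 1/2"
    by (simp add: q_def algebra_simps power2_eq_square)
  show ?thesis using push_pole[of "- 4 * v" z "x - 1/2" m "v - 1/2"] assms
    unfolding 1 2 by simp
qed

section \<open>Transfer of the residues along the loop\<close>

definition loop_pts :: "real \<Rightarrow> real \<Rightarrow> nat \<Rightarrow> real set" where
  "loop_pts v w n = (\<lambda>k. orbit1 v w k - 1/2) ` {..n} \<union> (\<lambda>k. orbit2 v w k - 1/2) ` {..n}"

text \<open>The pole at \<open>orbit2 v w k\<close> moves to \<open>orbit1 v w (Suc k)\<close> with
  exactly the residue required by \<open>res1\<close>. The surplus poles all sit at the critical
  value and add up to \<open>sum1\<close>, the only obstruction to invariance.\<close>

lemma push_res2: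
  assumes "finite S" "w \<noteq> 0" "Re z \<noteq> 0" "Im z \<noteq> 0"
    and "loop_pts v w n \<subseteq> S"
  shows "poles S (res2 v w n) z + poles S (res2 v w n) (- z)
    = (poles S (res1 v w n) (qc w z) - of_real (sum1 v w n) / (qc w z - of_real (w - 1/2))) * (of_real (2 * (- 4 * w)) * z)\<^sup>2"
proof -
  have "poles S (res2 v w n) z + poles S (res2 v w n) (- z)
     = (\<Sum>k<n. of_real (chain2 v w n k) / (z - of_real (orbit2 v w k - 1/2)) + of_real (chain2 v w n k) / (- z - of_real (orbit2 v w k - 1/2)))"
    using assms unfolding res2_def by (subst (1 2) poles_point_sum) (auto simp: sum.distrib loop_pts_def)
  also have "\<dots> = (\<Sum>k<n. (of_real (chain1 v w n (Suc k)) / (qc w z - of_real (orbit1 v w (Suc k) - 1/2))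
      - of_real (chain1 v w n (Suc k)) / (qc w z - of_real (w - 1/2))) * (of_real (2 * (- 4 * w)) * z)\<^sup>2)"
    unfolding chain2_def orbit1_Suc by (intro sum.cong refl push_pole_q assms)
  also have "\<dots> = (poles S (res1 v w n) (qc w z) - of_real (sum1 v w n) / (qc w z - of_real (w - 1/2))) * (of_real (2 * (- 4 * w)) * z)\<^sup>2"
    using assms unfolding res1_def sum1_def
    by (subst poles_point_sum) (auto simp: loop_pts_def sum_subtractf sum_divide_distrib simp flip: sum_distrib_right)
  finally show ?thesis .
qed

text \<open>As before, but the loop must be closed: a pole at the critical point cancels against its
  reflection, so index \<open>n\<close> may be replaced by index 0.\<close>

lemma push_res1:
  assumes "finite S" "v \<noteq> 0" "Re z \<noteq> 0" "Im z \<noteq> 0" "orbit1 v w n = 1/2"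
    and "loop_pts v w n \<subseteq> S"
  shows "poles S (res1 v w n) z + poles S (res1 v w n) (- z)
    = (poles S (res2 v w n) (qc v z) - of_real (sum2 v w n) / (qc v z - of_real (v - 1/2))) * (of_real (2 * (- 4 * v)) * z)\<^sup>2"
proof -
  let ?f = "\<lambda>k. of_real (chain1 v w n k) / (z - of_real (orbit1 v w k - 1/2)) + of_real (chain1 v w n k) / (- z - of_real (orbit1 v w k - 1/2))"
  have half: "?f k = 0" if "orbit1 v w k = 1/2" for k
  proof -
    have "orbit1 v w k - 1/2 = 0" using that by simp
    then show ?thesis by (simp only: of_real_0 diff_0_right) simp
  qed
  have "poles S (res1 v w n) z + poles S (res1 v w n) (- z) = (\<Sum>k<n. ?f (Suc k))"
    using assms unfolding res1_def by (subst (1 2) poles_point_sum) (auto simp: sum.distrib loop_pts_def)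
  also have "\<dots> = (\<Sum>k<n. ?f k)"
    using sum.lessThan_Suc_shift[of ?f n] half[of 0] half[of n] assms(5) by (simp del: sum.lessThan_Suc_shift)
  also have "\<dots> = (\<Sum>k<n. (of_real (chain2 v w n k) / (qc v z - of_real (orbit2 v w k - 1/2))
      - of_real (chain2 v w n k) / (qc v z - of_real (v - 1/2))) * (of_real (2 * (- 4 * v)) * z)\<^sup>2)"
  proof (intro sum.cong refl)
    fix k assume "k \<in> {..<n}"
    then have "chain1 v w n k = qd v (orbit1 v w k) * chain2 v w n k" by (simp add: chain1_eq_chain2)
    then show "?f k = (of_real (chain2 v w n k) / (qc v z - of_real (orbit2 v w k - 1/2))
      - of_real (chain2 v w n k) / (qc v z - of_real (v - 1/2))) * (of_real (2 * (- 4 * v)) * z)\<^sup>2"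
      using push_pole_q[OF assms(2-4), of "orbit1 v w k" "chain2 v w n k"] by (simp only: orbit2_def)
  qed
  also have "\<dots> = (poles S (res2 v w n) (qc v z) - of_real (sum2 v w n) / (qc v z - of_real (v - 1/2))) * (of_real (2 * (- 4 * v)) * z)\<^sup>2"
    using assms unfolding res2_def sum2_def
    by (subst poles_point_sum) (auto simp: loop_pts_def sum_subtractf sum_divide_distrib simp flip: sum_distrib_right)
  finally show ?thesis .
qed

text \<open>Minimality keeps the residue at the critical point from collecting further terms.
  Exchanging the parameters gives the same condition for the critical point of
  \<open>I\<^sub>2\<close>.\<close>

definition crit_loop :: "real \<Rightarrow> real \<Rightarrow> nat \<Rightarrow> bool" where
  "crit_loop v w n \<longleftrightarrow> 0 < n \<and> orbit1 v w n = 1/2 \<and> (\<forall>k. 0 < k \<and> k < n \<longrightarrow> orbit1 v w k \<noteq> 1/2)"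

lemma res1_0: "crit_loop v w n \<Longrightarrow> res1 v w n 0 = 1"
proof -
  assume c: "crit_loop v w n"
  then obtain m where n: "n = Suc m" by (cases n) (auto simp: crit_loop_def)
  have "res1 v w n 0 = (\<Sum>k<n. if k = m then 1 else 0)"
    unfolding res1_def point_sum_def
  proof (intro sum.cong refl)
    fix k assume "k \<in> {..<n}"
    then show "chain1 v w n (Suc k) * of_bool (orbit1 v w (Suc k) - 1/2 = 0) = (if k = m then 1 else 0)"
      using c by (auto simp: crit_loop_def n)
  qed
  then show ?thesis using n by simp
qed

text \<open>If the orbit passes through the critical point of \<open>I\<^sub>2\<close>, the
  transported derivative has the factor q_w'(1/2) = 0.\<close>

lemma res2_0: "res2 v w n 0 = 0"
  unfolding res2_def point_sum_def by (intro sum.neutral) (auto simp: chain2_def qd_def)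

section \<open>Nonvanishing and independence of the gradients\<close>

lemma sum_eq_0_if_D_eq_0:
  assumes "16 * v * w \<noteq> (1::real)" "0 = A / 2 - 2 * w * B" "0 = B / 2 - 2 * v * A"
  shows "A = 0" "B = 0"
proof -
  have A: "A = 4 * w * B" and B: "B = 4 * v * A" using assms by auto
  have "A * (1 - 16 * v * w) = 0" using A unfolding B by (simp add: algebra_simps)
  then show "A = 0" using assms by simp
  then show "B = 0" using B by simp
qed

text \<open>A vanishing gradient turns the rescaling relations into a homogeneous linear system for
  \<open>sum1\<close> and \<open>sum2\<close>, nonsingular as 16vw is not 1. Then the residues are
  invariant and vanish by rigidity, contradicting the residue 1 at the critical point.\<close>

lemma gradient_nonzero:
  assumes c: "crit_loop v w n" and vw: "v \<noteq> 0" "w \<noteq> 0" "16 * v * w \<noteq> 1"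
  shows "dv_orbit v w n \<noteq> 0 \<or> dw_orbit v w n \<noteq> 0"
proof (rule ccontr)
  assume "\<not> ?thesis"
  then have "sum2 v w n = 0" "sum1 v w n = 0"
    using rescale_I2[of v w n] rescale_I1[of v w n] c sum_eq_0_if_D_eq_0[OF vw(3), of "sum2 v w n" "sum1 v w n"]
    by (auto simp: crit_loop_def)
  then have "res1 v w n 0 = 0"
    using push_res1[of "loop_pts v w n" v _ w n] push_res2[of "loop_pts v w n" w _ v n] c vw
    by (intro poles_rigidity[of "loop_pts v w n" "- 4 * v" "- 4 * w" "res2 v w n" "v - 1/2" _ "w - 1/2"])
       (auto simp: crit_loop_def loop_pts_def intro!: image_eqI[of _ _ n])
  then show False using res1_0[OF c] by simp
qed

text \<open>The second loop starts in \<open>I\<^sub>2\<close>, so its gradient in (v, w) is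
  (\<open>dw_orbit w v m\<close>, \<open>dv_orbit w v m\<close>), and its \<open>res2\<close> lives
  on \<open>I\<^sub>1\<close>. A linear relation between the gradients makes the same combination of
  residues invariant.\<close>

lemma transversal:
  assumes c: "crit_loop v w n" "crit_loop w v m" and vw: "v \<noteq> 0" "w \<noteq> 0" "16 * v * w \<noteq> 1"
  shows "dv_orbit v w n * dv_orbit w v m \<noteq> dw_orbit v w n * dw_orbit w v m"
proof
  assume eq: "dv_orbit v w n * dv_orbit w v m = dw_orbit v w n * dw_orbit w v m"
  obtain a b where ab: "a \<noteq> 0 \<or> b \<noteq> 0" "a * dv_orbit v w n + b * dw_orbit w v m = 0" "a * dw_orbit v w n + b * dv_orbit w v m = 0"
  proof (cases "dv_orbit v w n = 0 \<and> dw_orbit v w n = 0")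
    case True
    then show ?thesis by (intro that[of 1 0]) auto
  next
    case False
    show ?thesis
    proof (cases "dv_orbit v w n = 0")
      case True
      with False show ?thesis using eq by (intro that[of "- dv_orbit w v m" "dw_orbit v w n"]) (auto simp: algebra_simps)
    next
      case F: False
      show ?thesis using F eq by (intro that[of "- dw_orbit w v m" "dv_orbit v w n"]) (auto simp: algebra_simps)
    qed
  qed
  define A where "A = a * sum2 v w n + b * sum1 w v m"
  define B where "B = a * sum1 v w n + b * sum2 w v m"
  have x: "orbit1 v w n = 1/2" "orbit1 w v m = 1/2" using c by (auto simp: crit_loop_def)
  have "0 = v * (a * dv_orbit v w n + b * dw_orbit w v m) - 2 * w * (a * dw_orbit v w n + b * dv_orbit w v m)"
    using ab by simp
  also have "\<dots> = a * (v * dv_orbit v w n - 2 * w * dw_orbit v w n) + b * (v * dw_orbit w v m - 2 * w * dv_orbit w v m)"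
    by (simp add: algebra_simps)
  also have "\<dots> = A / 2 - 2 * w * B"
    unfolding rescale_I2 rescale_I1[OF x(2)] by (simp add: A_def B_def algebra_simps)
  finally have 1: "0 = A / 2 - 2 * w * B" .
  have "0 = w * (a * dw_orbit v w n + b * dv_orbit w v m) - 2 * v * (a * dv_orbit v w n + b * dw_orbit w v m)"
    using ab by simp
  also have "\<dots> = a * (w * dw_orbit v w n - 2 * v * dv_orbit v w n) + b * (w * dv_orbit w v m - 2 * v * dw_orbit w v m)"
    by (simp add: algebra_simps)
  also have "\<dots> = B / 2 - 2 * v * A"
    unfolding rescale_I2 rescale_I1[OF x(1)] by (simp add: A_def B_def algebra_simps)
  finally have 2: "0 = B / 2 - 2 * v * A" .
  have AB: "A = 0" "B = 0" using sum_eq_0_if_D_eq_0[OF vw(3) 1 2] by auto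
  define S where "S = loop_pts v w n \<union> loop_pts w v m"
  define \<alpha> where "\<alpha> = (\<lambda>p. a * res1 v w n p + b * res2 w v m p)"
  define \<beta> where "\<beta> = (\<lambda>p. a * res2 v w n p + b * res1 w v m p)"
  have S: "finite S" "0 \<in> S" "loop_pts v w n \<subseteq> S" "loop_pts w v m \<subseteq> S"
    unfolding S_def loop_pts_def by (auto intro: image_eqI[of _ _ 0])
  have lincomb: "r * ((x - p / d) * e) + s * ((y - u / d) * e) = (r * x + s * y - (r * p + s * u) / d) * e"
    for r s x y p u d e :: complex
    by (simp add: algebra_simps add_divide_distrib)
  have push1: "poles S \<beta> (qc v z) * (of_real (2 * (- 4 * v)) * z)\<^sup>2 = poles S \<alpha> z + poles S \<alpha> (- z)"
    if "Re z \<noteq> 0" "Im z \<noteq> 0" for z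
  proof -
    have "poles S \<alpha> z + poles S \<alpha> (- z) = of_real a * (poles S (res1 v w n) z + poles S (res1 v w n) (- z))
      + of_real b * (poles S (res2 w v m) z + poles S (res2 w v m) (- z))"
      unfolding \<alpha>_def poles_linear by (simp add: algebra_simps)
    also have "\<dots> = (poles S \<beta> (qc v z) - of_real A / (qc v z - of_real (v - 1/2))) * (of_real (2 * (- 4 * v)) * z)\<^sup>2"
      unfolding push_res1[OF S(1) vw(1) that x(1) S(3)] push_res2[OF S(1) vw(1) that S(4)] \<beta>_def poles_linear A_def
        of_real_add of_real_mult[of a] of_real_mult[of b] by (rule lincomb)
    finally show ?thesis using AB by simp
  qed
  have push2: "poles S \<alpha> (qc w z) * (of_real (2 * (- 4 * w)) * z)\<^sup>2 = poles S \<beta> z + poles S \<beta> (- z)"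
    if "Re z \<noteq> 0" "Im z \<noteq> 0" for z
  proof -
    have "poles S \<beta> z + poles S \<beta> (- z) = of_real a * (poles S (res2 v w n) z + poles S (res2 v w n) (- z))
      + of_real b * (poles S (res1 w v m) z + poles S (res1 w v m) (- z))"
      unfolding \<beta>_def poles_linear by (simp add: algebra_simps)
    also have "\<dots> = (poles S \<alpha> (qc w z) - of_real B / (qc w z - of_real (w - 1/2))) * (of_real (2 * (- 4 * w)) * z)\<^sup>2"
      unfolding push_res1[OF S(1) vw(2) that x(2) S(4)] push_res2[OF S(1) vw(2) that S(3)] \<alpha>_def poles_linear B_def
        of_real_add of_real_mult[of a] of_real_mult[of b] by (rule lincomb)
    finally show ?thesis using AB by simp
  qed
  have nz: "- 4 * v \<noteq> 0" "- 4 * w \<noteq> 0" using vw by auto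
  \<comment> \<open>At the critical point of \<open>I\<^sub>1\<close> only the left loop has a
    residue, and at that of \<open>I\<^sub>2\<close> only the right one.\<close>
  have "\<alpha> 0 = 0" by (rule poles_rigidity[OF S(1) nz push1 push2 S(2)])
  then have "a = 0" by (simp add: \<alpha>_def res1_0[OF c(1)] res2_0)
  have "\<beta> 0 = 0" by (rule poles_rigidity[OF S(1) nz(2,1) push2 push1 S(2)])
  then have "b = 0" by (simp add: \<beta>_def res1_0[OF c(2)] res2_0)
  show False using ab \<open>a = 0\<close> \<open>b = 0\<close> by simp
qed


text \<open>On the edge \<open>w = 1\<close> the second critical point is mapped to 1 and then to the fixed point 0; the
  extra poles at 0 and 1 restore a fixed vector of the transfer operator.\<close>

lemma edge_transversal:
  assumes c: "crit_loop v 1 n" and v: "v \<noteq> 0"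
  shows "dv_orbit v 1 n \<noteq> 0"
proof
  assume D: "dv_orbit v 1 n = 0"
  define A where "A = sum2 v 1 n"
  define B where "B = sum1 v 1 n"
  have x: "orbit1 v 1 n = 1/2" using c by (auto simp: crit_loop_def)
  \<comment> \<open>Eliminate the derivative in w from the two rescaling relations.\<close>
  have AB: "B = A / 2 - 4 * v * A"
    using rescale_I2[of v 1 n] rescale_I1[OF x] D by (simp add: A_def B_def)
  define S where "S = loop_pts v 1 n \<union> {1/2, - 1/2}"
  define \<epsilon> where "\<epsilon> = (\<lambda>r p :: real. of_bool (p = r) :: real)"
  \<comment> \<open>The points 0 and 1 are shifted to -1/2 and 1/2. Under q_1 the pole -A at 0
    yields -A/4 at 0 and A/4 at the critical value 1, where the defect -B is added. Under q_v the
    poles at 0 and 1 yield (B - A/2)/(4v) at 0, which is -A by \<open>AB\<close>, and A at the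
    critical value v, which cancels the defect there.\<close>
  define \<alpha> where "\<alpha> = (\<lambda>p. 1 * res1 v 1 n p + 1 * ((- A / 4) * \<epsilon> (- 1/2) p + (A / 4 - B) * \<epsilon> (1/2) p))"
  define \<beta> where "\<beta> = (\<lambda>p. 1 * res2 v 1 n p + (- A) * \<epsilon> (- 1/2) p)"
  have S: "finite S" "0 \<in> S" "loop_pts v 1 n \<subseteq> S"
    unfolding S_def loop_pts_def by (auto intro: image_eqI[of _ _ 0])
  have \<epsilon>: "poles S (\<epsilon> r) z = 1 / (z - of_real r)" if "r \<in> S" for r z
    using that S(1) by (simp add: poles_def \<epsilon>_def of_bool_def if_distrib[of of_real] if_distrib[of "\<lambda>x. x / _"] sum.delta cong: if_cong)
  have rS: "- 1/2 \<in> S" "1/2 \<in> S" by (auto simp: S_def)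
  have lincomb: "(y - p / d) * e - a / 4 * ((k * r - k / d) * e) + (a / 4 - b) * (- (k * r - k / d) * e)
      = (y - p / d) * e + (b - a / 2) * k * ((r - 1 / d) * e)" for y p d e a b k r :: complex
    by (simp add: algebra_simps add_divide_distrib diff_divide_distrib)
  have push1: "poles S \<beta> (qc v z) * (of_real (2 * (- 4 * v)) * z)\<^sup>2 = poles S \<alpha> z + poles S \<alpha> (- z)"
    if z: "Re z \<noteq> 0" "Im z \<noteq> 0" for z
  proof -
    let ?e = "(of_real (2 * (- 4 * v)) * z)\<^sup>2"
    let ?d = "qc v z - of_real (v - 1/2)"
    have e0: "poles S (\<epsilon> (-1/2)) z + poles S (\<epsilon> (-1/2)) (- z) = (of_real (1 / (4 * v)) * poles S (\<epsilon> (-1/2)) (qc v z) - of_real (1 / (4 * v)) / ?d) * ?e"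
      using push_pole_q[OF v z, of 0 "1 / (4 * v)"] v unfolding \<epsilon>[OF rS(1)] by (simp add: qd_def q_def)
    have e1: "poles S (\<epsilon> (1/2)) z + poles S (\<epsilon> (1/2)) (- z) = - (of_real (1 / (4 * v)) * poles S (\<epsilon> (-1/2)) (qc v z) - of_real (1 / (4 * v)) / ?d) * ?e"
      using push_pole_q[OF v z, of 1 "- 1 / (4 * v)"] v unfolding \<epsilon>[OF rS(1)] \<epsilon>[OF rS(2)] by (simp add: qd_def q_def algebra_simps)
    have "poles S \<alpha> z + poles S \<alpha> (- z) = (poles S (res1 v 1 n) z + poles S (res1 v 1 n) (- z))
       - of_real (A / 4) * (poles S (\<epsilon> (-1/2)) z + poles S (\<epsilon> (-1/2)) (- z))
       + of_real (A / 4 - B) * (poles S (\<epsilon> (1/2)) z + poles S (\<epsilon> (1/2)) (- z))"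
      unfolding \<alpha>_def poles_linear by (simp add: algebra_simps)
    also have "\<dots> = (poles S (res2 v 1 n) (qc v z) - of_real A / ?d) * ?e
       + of_real ((B - A / 2) * (1 / (4 * v))) * ((poles S (\<epsilon> (-1/2)) (qc v z) - 1 / ?d) * ?e)"
      unfolding push_res1[OF S(1) v z x S(3)] e0 e1 A_def[symmetric] of_real_mult[of _ "1 / (4 * v)"] of_real_divide[of A] of_real_diff
      by (simp only: lincomb of_real_numeral)
    also have "(B - A / 2) * (1 / (4 * v)) = - A" using AB v by (simp add: field_simps)
    also have "(poles S (res2 v 1 n) (qc v z) - of_real A / ?d) * ?e
       + of_real (- A) * ((poles S (\<epsilon> (-1/2)) (qc v z) - 1 / ?d) * ?e) = poles S \<beta> (qc v z) * ?e"
      unfolding \<beta>_def poles_linear by (simp add: algebra_simps)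
    finally show ?thesis by simp
  qed
  have push2: "poles S \<alpha> (qc 1 z) * (of_real (2 * (- 4 * 1)) * z)\<^sup>2 = poles S \<beta> z + poles S \<beta> (- z)"
    if z: "Re z \<noteq> 0" "Im z \<noteq> 0" for z
  proof -
    let ?e = "(of_real (2 * (- 4 * 1)) * z)\<^sup>2"
    let ?d = "qc 1 z - of_real (1 - 1/2)"
    have e0: "poles S (\<epsilon> (-1/2)) z + poles S (\<epsilon> (-1/2)) (- z) = (1 / 4 * poles S (\<epsilon> (-1/2)) (qc 1 z) - 1 / 4 / ?d) * ?e"
      using push_pole_q[of 1, OF _ z, of 0 "1 / 4"] unfolding \<epsilon>[OF rS(1)] by (simp add: qd_def q_def)
    have d: "1 / ?d = poles S (\<epsilon> (1/2)) (qc 1 z)" by (simp add: \<epsilon>[OF rS(2)])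
    have "poles S \<beta> z + poles S \<beta> (- z) = (poles S (res2 v 1 n) z + poles S (res2 v 1 n) (- z))
       - of_real A * (poles S (\<epsilon> (-1/2)) z + poles S (\<epsilon> (-1/2)) (- z))"
      unfolding \<beta>_def poles_linear by (simp add: algebra_simps)
    also have "\<dots> = (poles S (res1 v 1 n) (qc 1 z) - of_real B * (1 / ?d)) * ?e
       - of_real A * ((1 / 4 * poles S (\<epsilon> (-1/2)) (qc 1 z) - 1 / 4 * (1 / ?d)) * ?e)"
      unfolding push_res2[of S 1, OF S(1) one_neq_zero z S(3)] e0 B_def[symmetric] by simp
    also have "\<dots> = poles S \<alpha> (qc 1 z) * ?e"
      unfolding d \<alpha>_def poles_linear by (simp add: algebra_simps)
    finally show ?thesis by simp
  qed
  have nz: "- 4 * v \<noteq> 0" "- 4 * 1 \<noteq> (0::real)" using v by auto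
  have "\<alpha> 0 = 0" by (rule poles_rigidity[OF S(1) nz push1 push2 S(2)])
  \<comment> \<open>The extra poles lie at -1/2 and 1/2 and leave the residue at 0
    unchanged.\<close>
  then show False using res1_0[OF c] by (simp add: \<alpha>_def \<epsilon>_def)
qed


subsection \<open>Charts of zero sets in the plane\<close>

lemma continuous_on_orbit1_orbit2:
  "continuous_on UNIV (\<lambda>p. orbit1 (fst p) (snd p) k) \<and> continuous_on UNIV (\<lambda>p. orbit2 (fst p) (snd p) k)"
proof (induction k)
  case 0
  then show ?case unfolding orbit2_def q_def by (auto intro!: continuous_intros)
next
  case (Suc k)
  then have 1: "continuous_on UNIV (\<lambda>p. orbit1 (fst p) (snd p) (Suc k))"
    unfolding orbit1_Suc q_def by (auto intro!: continuous_intros)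
  then show ?case unfolding orbit2_def[of _ _ "Suc k"] q_def by (auto intro!: continuous_intros)
qed

lemmas continuous_on_orbit1 = continuous_on_orbit1_orbit2[THEN conjunct1]
  and continuous_on_orbit2 = continuous_on_orbit1_orbit2[THEN conjunct2]

lemma continuous_on_D:
  "continuous_on UNIV (\<lambda>p. dv_orbit (fst p) (snd p) k)" "continuous_on UNIV (\<lambda>p. dw_orbit (fst p) (snd p) k)"
  by (induction k)
     (auto simp: qd_def q_def intro!: continuous_intros continuous_on_orbit1 continuous_on_orbit2)

lemma has_derivative_orbit1:
  "((\<lambda>p. orbit1 (fst p) (snd p) k) has_derivative
    (\<lambda>h. dv_orbit (fst p) (snd p) k * fst h + dw_orbit (fst p) (snd p) k * snd h)) (at p)"
proof (induction k)
  case (Suc k)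
  have "((\<lambda>p. orbit2 (fst p) (snd p) k) has_derivative
    (\<lambda>h. (qd (fst p) (orbit1 (fst p) (snd p) k) * dv_orbit (fst p) (snd p) k + q 1 (orbit1 (fst p) (snd p) k)) * fst h
        + qd (fst p) (orbit1 (fst p) (snd p) k) * dw_orbit (fst p) (snd p) k * snd h)) (at p)"
    unfolding orbit2_def q_def
    by (rule derivative_eq_intros Suc refl | simp add: qd_def algebra_simps)+
  note orbit2 = this
  show ?case unfolding orbit1_Suc q_def
    by (rule derivative_eq_intros orbit2 refl | simp add: qd_def q_def algebra_simps)+
qed simp

text \<open>The inverse function theorem for (F, snd) straightens the zero set. \<open>K\<close> is
  the whole line at an inner point and the half line \<open>{0..}\<close> at the edge; its
  invariance under scaling allows a chart on the unit interval.\<close>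

lemma implicit_chart:
  fixes F F1 F2 :: "real \<times> real \<Rightarrow> real"
  assumes U: "open U" "p \<in> U"
    and der: "\<And>x. (F has_derivative (\<lambda>h. F1 x * fst h + F2 x * snd h)) (at x)"
    and cont: "continuous_on UNIV F1" "continuous_on UNIV F2"
    and p: "F p = 0" "F1 p \<noteq> 0" and K: "0 \<in> K" and K_scale: "\<And>e t. e > 0 \<Longrightarrow> e * t \<in> K \<longleftrightarrow> t \<in> K"
    and B: "\<And>x. x \<in> U \<Longrightarrow> x \<in> B \<longleftrightarrow> F x = 0 \<and> snd p - snd x \<in> K"
  shows "\<exists>c c'. C1_chart ({-1<..<1} \<inter> K) B p c c'"
proof -
  define \<Phi> where "\<Phi> = (\<lambda>x. (F x, snd x))"
  define f' where "f' = (\<lambda>x. F1 x *\<^sub>R Blinfun (\<lambda>h. (fst h, 0)) + F2 x *\<^sub>R Blinfun (\<lambda>h. (snd h, 0))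
    + Blinfun (\<lambda>h. (0, snd h)) :: (real \<times> real) \<Rightarrow>\<^sub>L (real \<times> real))"
  have bl: "bounded_linear (\<lambda>h::real\<times>real. (fst h, 0::real))" "bounded_linear (\<lambda>h::real\<times>real. (snd h, 0::real))"
    "bounded_linear (\<lambda>h::real\<times>real. (0::real, snd h))"
    by (intro bounded_linear_Pair bounded_linear_fst bounded_linear_snd bounded_linear_zero)+
  have f': "blinfun_apply (f' x) = (\<lambda>h. (F1 x * fst h + F2 x * snd h, snd h))" for x
    by (simp add: f'_def blinfun.bilinear_simps bounded_linear_Blinfun_apply bl fun_eq_iff)
  have bi: "bounded_linear (\<lambda>h::real\<times>real. ((fst h - F2 p * snd h) / F1 p, snd h))"
    by (intro bounded_linear_Pair bounded_linear_divide bounded_linear_sub bounded_linear_fst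
        bounded_linear_snd bounded_linear_mult_const bounded_linear_const_mult bounded_linear_compose[OF bounded_linear_divide])
  have inv: "Blinfun (\<lambda>h::real\<times>real. ((fst h - F2 p * snd h) / F1 p, snd h)) o\<^sub>L f' p = id_blinfun"
    by (rule blinfun_eqI) (simp add: f' bounded_linear_Blinfun_apply bi p)
  have derP: "(\<Phi> has_derivative blinfun_apply (f' x)) (at x)" for x
    unfolding f' \<Phi>_def by (intro has_derivative_Pair der has_derivative_snd has_derivative_ident)
  have contP: "continuous_on U f'"
    unfolding f'_def by (intro continuous_intros continuous_on_subset[OF cont(1)] continuous_on_subset[OF cont(2)]) auto
  obtain U' V g g' where *: "open U'" "U' \<subseteq> U" "p \<in> U'" "open V" "\<Phi> p \<in> V" "homeomorphism U' V \<Phi> g"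
    "\<And>y. y \<in> V \<Longrightarrow> (g has_derivative (g' y)) (at y)"
    "\<And>y. y \<in> V \<Longrightarrow> g' y = inv (blinfun_apply (f'(g y)))"
    "\<And>y. y \<in> V \<Longrightarrow> bij (blinfun_apply (f'(g y)))"
    by (rule inverse_function_theorem[OF U(1) derP contP U(2) inv]) blast
  have Pp: "\<Phi> p = (0, snd p)" by (simp add: \<Phi>_def p)
  have "continuous_on UNIV (\<lambda>t::real. (0::real, snd p - t))" by (intro continuous_intros)
  then have "open ((\<lambda>t::real. (0::real, snd p - t)) -` V)" using *(4) by (simp add: open_vimage)
  moreover have "0 \<in> (\<lambda>t::real. (0::real, snd p - t)) -` V" using *(5) Pp by simp
  ultimately obtain e where e: "e > 0" "ball 0 e \<subseteq> (\<lambda>t::real. (0::real, snd p - t)) -` V"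
    using open_contains_ball by blast
  define J where "J = {-1<..<1} \<inter> K"
  \<comment> \<open>The parameter is the second coordinate, slowed down by \<open>e\<close> to stay
    in \<open>V\<close> and run downwards, so that nonnegative parameters enter the square from its
    upper edge. The velocity \<open>c'\<close> comes from implicit differentiation.\<close>
  define c where "c = (\<lambda>t. g (0, snd p - e * t))"
  define c' where "c' = (\<lambda>t. (e * F2 (c t) / F1 (c t), - e))"
  define W where "W = U' \<inter> {x. \<bar>snd p - snd x\<bar> < e}"
  have inV: "(0, snd p - e * t) \<in> V" if "t \<in> J" for t
    using that e by (auto simp: J_def dist_real_def abs_mult subset_iff)
  have cU: "c t \<in> U'" and Pc: "\<Phi> (c t) = (0, snd p - e * t)" if "t \<in> J" for t
    using inV[OF that] *(6) by (auto simp: c_def homeomorphism_def)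
  have Fc: "F (c t) = 0" "snd (c t) = snd p - e * t" if "t \<in> J" for t
    using Pc[OF that] by (auto simp: \<Phi>_def)
  have F1c: "F1 (c t) \<noteq> 0" if t: "t \<in> J" for t
  proof
    assume 0: "F1 (c t) = 0"
    have "inj (blinfun_apply (f' (c t)))" using *(9)[OF inV[OF t]] by (simp add: c_def bij_is_inj)
    then have "(1::real, 0::real) = (0, 0)" by (rule injD) (simp add: f' 0)
    then show False by simp
  qed
  have derc: "(c has_vector_derivative c' t) (at t within J)" if t: "t \<in> J" for t
  proof -
    have gt: "g (0, snd p - e * t) = c t" by (simp add: c_def)
    have "g' (0, snd p - e * t) (0, - e) = c' t"
      using *(9)[OF inV[OF t]] F1c[OF t] unfolding *(8)[OF inV[OF t]] gt
      by (intro inv_f_eq bij_is_inj) (auto simp: f' c'_def)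
    moreover have "((\<lambda>t. (0, snd p - e * t)) has_vector_derivative (0, - e)) (at t within J)"
      by (auto intro!: derivative_eq_intros has_vector_derivative_Pair simp: has_vector_derivative_def)
    from has_derivative_compose[OF this[unfolded has_vector_derivative_def] *(7)[OF inV[OF t]]]
    have "(c has_derivative (\<lambda>x. g' (0, snd p - e * t) (x *\<^sub>R (0, - e)))) (at t within J)"
      by (simp add: c_def del: scaleR_Pair)
    moreover have "linear (g' (0, snd p - e * t))"
      using *(7)[OF inV[OF t]] has_derivative_linear by blast
    ultimately show ?thesis by (simp add: has_vector_derivative_def linear_scale del: scaleR_Pair)
  qed
  then have contc: "continuous_on J c"
    by (intro continuous_on_vector_derivative)
  have "continuous_on J c'"
    unfolding c'_def using F1c
    by (intro continuous_intros continuous_on_compose2[OF cont(1) contc] continuous_on_compose2[OF cont(2) contc]) auto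
  moreover have "c 0 = p" using *(3,6) Pp by (auto simp: c_def homeomorphism_def)
  moreover have "open W" unfolding W_def
    by (intro open_Int *(1) open_Collect_less continuous_intros)
  moreover have "homeomorphism J (B \<inter> W) c (\<lambda>x. (snd p - snd x) / e)"
  proof (rule homeomorphismI[OF contc])
    show "continuous_on (B \<inter> W) (\<lambda>x. (snd p - snd x) / e)" using e by (intro continuous_intros) auto
    show "c ` J \<subseteq> B \<inter> W"
    proof (rule image_subsetI, rule IntI)
      fix t assume t: "t \<in> J"
      show "c t \<in> B" using B[of "c t"] cU[OF t] *(2) Fc[OF t] t e K_scale by (auto simp: J_def)
      show "c t \<in> W" using cU[OF t] Fc[OF t] t e by (auto simp: W_def J_def abs_mult)
    qed
    show "(\<lambda>x. (snd p - snd x) / e) ` (B \<inter> W) \<subseteq> J"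
    proof (rule image_subsetI)
      fix x assume "x \<in> B \<inter> W"
      then have x: "x \<in> B" "x \<in> W" by auto
      then have "snd p - snd x \<in> K" using B[of x] *(2) by (auto simp: W_def)
      then have "(snd p - snd x) / e \<in> K" using K_scale[of e "(snd p - snd x) / e"] e by simp
      moreover have "\<bar>(snd p - snd x) / e\<bar> < 1" using x e by (auto simp: W_def)
      ultimately show "(snd p - snd x) / e \<in> J" unfolding J_def by (auto simp only: abs_less_iff greaterThanLessThan_iff Int_iff)
    qed
    show "(snd p - snd (c t)) / e = t" if "t \<in> J" for t using Fc[OF that] e by simp
    show "c ((snd p - snd x) / e) = x" if "x \<in> B \<inter> W" for x
    proof -
      have "x \<in> U'" using that by (auto simp: W_def)
      moreover have "F x = 0" using B[of x] that *(2) by (auto simp: W_def)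
      ultimately show ?thesis using *(6) e by (auto simp: c_def homeomorphism_def \<Phi>_def)
    qed
  qed
  moreover have "c' t \<noteq> 0" for t using e by (simp add: c'_def zero_prod_def)
  ultimately have "C1_chart J B p c c'"
    unfolding C1_chart_def using derc by blast
  then show ?thesis unfolding J_def by blast
qed

lemma continuous_on_swap': "continuous_on S (prod.swap :: 'a::topological_space \<times> 'b::topological_space \<Rightarrow> _)"
  unfolding prod.swap_def by (intro continuous_intros)

lemma C1_chart_swap:
  fixes c :: "real \<Rightarrow> real \<times> real"
  assumes "C1_chart J B p c c'"
  shows "C1_chart J (prod.swap ` B) (prod.swap p) (prod.swap \<circ> c) (prod.swap \<circ> c')"
proof -
  have bl: "bounded_linear (prod.swap :: real \<times> real \<Rightarrow> _)"
    unfolding prod.swap_def by (intro bounded_linear_Pair bounded_linear_fst bounded_linear_snd)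
  from assms obtain U g where U: "open U" "homeomorphism J (B \<inter> U) c g"
    and c: "c 0 = p" "\<And>t. t \<in> J \<Longrightarrow> (c has_vector_derivative c' t) (at t within J)" "\<And>t. t \<in> J \<Longrightarrow> c' t \<noteq> 0"
      "continuous_on J c'"
    unfolding C1_chart_def by blast
  have sw: "homeomorphism (B \<inter> U) (prod.swap ` (B \<inter> U)) prod.swap prod.swap"
    by (rule homeomorphismI) (auto intro: continuous_on_swap')
  have "prod.swap ` (B \<inter> U) = prod.swap ` B \<inter> prod.swap -` U" by (auto simp: image_iff)
  with homeomorphism_compose[OF U(2) sw]
  have "homeomorphism J (prod.swap ` B \<inter> prod.swap -` U) (prod.swap \<circ> c) (g \<circ> prod.swap)" by simp
  moreover have "open ((prod.swap :: real \<times> real \<Rightarrow> _) -` U)"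
    by (intro open_vimage U continuous_on_swap')
  moreover have "continuous_on J (prod.swap \<circ> c')"
    using c(4) continuous_on_swap' by (intro continuous_on_compose) auto
  moreover have "prod.swap (c' t) \<noteq> 0" if "t \<in> J" for t
    using c(3)[OF that] by (cases "c' t") (auto simp: zero_prod_def)
  moreover have "(prod.swap \<circ> c has_vector_derivative prod.swap (c' t)) (at t within J)" if "t \<in> J" for t
    using bounded_linear.has_vector_derivative[OF bl c(2)[OF that]] by (simp add: o_def)
  ultimately show ?thesis unfolding C1_chart_def using c(1) by auto
qed


subsection \<open>Bones as zero sets\<close>

lemma funpow_orbit1: "((q w \<circ> q v) ^^ m) (orbit1 v w k) = orbit1 v w (m + k)"
  by (simp add: orbit1_def funpow_add)

lemma least_period_iff_crit_loop: "least_period (q w \<circ> q v) n (1/2) \<longleftrightarrow> crit_loop v w n"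
  by (simp add: least_period_def crit_loop_def orbit1_def)

lemma orbit1_mod: "orbit1 v w n = 1/2 \<Longrightarrow> orbit1 v w (k mod n) = orbit1 v w k"
  unfolding orbit1_def by (rule funpow_mod_eq)

text \<open>Two equal points at times i < j, followed up to time n, would give a return to 1/2 at
  time n - j + i, before n.\<close>

lemma crit_loop_inj:
  assumes c: "crit_loop v w n"
  shows "inj_on (orbit1 v w) {..<n}"
proof (rule linorder_inj_onI)
  fix i j assume ij: "i < j" "j \<in> {..<n}"
  show "orbit1 v w i \<noteq> orbit1 v w j"
  proof
    assume "orbit1 v w i = orbit1 v w j"
    then have "orbit1 v w ((n - j) + i) = orbit1 v w ((n - j) + j)" by (simp flip: funpow_orbit1)
    then have "orbit1 v w ((n - j) + i) = 1/2" using c ij by (simp add: crit_loop_def)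
    moreover have "0 < (n - j) + i" "(n - j) + i < n" using ij by auto
    ultimately show False using c unfolding crit_loop_def by blast
  qed
qed auto

lemma crit_loop_inj_orbit2:
  assumes c: "crit_loop v w n"
  shows "inj_on (orbit2 v w) {..<n}"
proof (rule inj_onI)
  fix i j assume ij: "i \<in> {..<n}" "j \<in> {..<n}" "orbit2 v w i = orbit2 v w j"
  then have "orbit1 v w (Suc i mod n) = orbit1 v w (Suc j mod n)"
    using c by (simp add: orbit1_mod crit_loop_def orbit1_Suc)
  then have "Suc i mod n = Suc j mod n"
    using crit_loop_inj[OF c] ij by (auto dest!: inj_onD)
  then show "i = j" using ij by (auto simp: mod_Suc split: if_splits)
qed

lemma forward_orbit_eq:
  assumes c: "crit_loop v w n"
  shows "forward_orbit (q w \<circ> q v) (1/2) = orbit1 v w ` {..<n}"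
proof -
  have "forward_orbit (q w \<circ> q v) (1/2) = range (orbit1 v w)"
    by (simp add: forward_orbit_def orbit1_def)
  also have "\<dots> = orbit1 v w ` {..<n}"
  proof safe
    fix k
    have "orbit1 v w k = orbit1 v w (k mod n)" using c by (simp add: orbit1_mod crit_loop_def)
    moreover have "k mod n < n" using c by (simp add: crit_loop_def)
    ultimately show "orbit1 v w k \<in> orbit1 v w ` {..<n}" by blast
  qed auto
  finally show ?thesis .
qed

text \<open>\<open>a i\<close> and \<open>b j\<close> are the times at which the orbit visits the points \<open>x i\<close> and \<open>y j\<close> of the order-data;
  the itinerary is combinatorial, so that it persists under small perturbations.\<close>

definition itinerary :: "nat \<Rightarrow> (nat \<Rightarrow> nat) \<Rightarrow> (nat \<Rightarrow> nat) \<Rightarrow> (nat \<Rightarrow> nat) \<Rightarrow> (nat \<Rightarrow> nat) \<Rightarrow> bool" where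
  "itinerary n \<sigma> \<tau> a b \<longleftrightarrow> \<sigma> permutes {1..n} \<and> \<tau> permutes {1..n} \<and>
     bij_betw a {1..n} {..<n} \<and> bij_betw b {1..n} {..<n} \<and>
     (\<forall>i\<in>{1..n}. a i = b (\<sigma> i)) \<and> (\<forall>j\<in>{1..n}. a (\<tau> j) = Suc (b j) mod n)"

definition ordered_by :: "nat \<Rightarrow> (nat \<Rightarrow> nat) \<Rightarrow> (nat \<Rightarrow> nat) \<Rightarrow> real \<times> real \<Rightarrow> bool" where
  "ordered_by n a b p \<longleftrightarrow> (\<forall>i\<in>{1..n}. \<forall>j\<in>{1..n}. i < j \<longrightarrow>
     orbit1 (fst p) (snd p) (a i) < orbit1 (fst p) (snd p) (a j) \<and> orbit2 (fst p) (snd p) (b i) < orbit2 (fst p) (snd p) (b j))"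

lemma open_ordered_by: "open {p. ordered_by n a b p}"
proof -
  have "open {p :: real \<times> real. i < j \<longrightarrow>
     orbit1 (fst p) (snd p) (a i) < orbit1 (fst p) (snd p) (a j) \<and> orbit2 (fst p) (snd p) (b i) < orbit2 (fst p) (snd p) (b j)}" for i j
    by (cases "i < j") (auto intro!: open_Collect_conj open_Collect_less continuous_on_orbit1 continuous_on_orbit2)
  then have "open (\<Inter>i\<in>{1..n}. \<Inter>j\<in>{1..n}. {p :: real \<times> real. i < j \<longrightarrow>
     orbit1 (fst p) (snd p) (a i) < orbit1 (fst p) (snd p) (a j) \<and> orbit2 (fst p) (snd p) (b i) < orbit2 (fst p) (snd p) (b j)})"
    by (intro open_INT) auto
  also have "\<dots> = {p. ordered_by n a b p}" by (auto simp: ordered_by_def)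
  finally show ?thesis .
qed

lemma left_boneD:
  assumes "p \<in> left_bone n \<sigma> \<tau>"
  obtains a b where "itinerary n \<sigma> \<tau> a b" "ordered_by n a b p" "crit_loop (fst p) (snd p) n"
    "p \<in> param_space"
proof -
  obtain v w where p: "p = (v, w)" by force
  have c: "crit_loop v w n" and P: "p \<in> param_space"
    and od: "has_order_data (q v) (q w) (orbit1 v w ` {..<n}) (orbit2 v w ` {..<n}) n \<sigma> \<tau>"
    using assms forward_orbit_eq[of v w n]
    by (auto simp: p left_bone_def periodic_on_I1_def least_period_iff_crit_loop orbit2_def image_image)
  from od obtain x y where xy: "\<sigma> permutes {1..n}" "\<tau> permutes {1..n}"
    "strict_mono_on {1..n} x" "x ` {1..n} = orbit1 v w ` {..<n}"
    "strict_mono_on {1..n} y" "y ` {1..n} = orbit2 v w ` {..<n}"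
    and xy': "\<forall>i\<in>{1..n}. q v (x i) = y (\<sigma> i)" "\<forall>j\<in>{1..n}. q w (y j) = x (\<tau> j)"
    unfolding has_order_data_def by (elim conjE exE) (rule that)
  have bx: "bij_betw (orbit1 v w) {..<n} (x ` {1..n})" and by': "bij_betw (orbit2 v w) {..<n} (y ` {1..n})"
    using crit_loop_inj[OF c] crit_loop_inj_orbit2[OF c] xy by (auto simp: bij_betw_def)
  define a where "a = inv_into {..<n} (orbit1 v w) \<circ> x"
  define b where "b = inv_into {..<n} (orbit2 v w) \<circ> y"
  have ba: "bij_betw a {1..n} {..<n}" unfolding a_def
    using xy(3) by (intro bij_betw_trans[OF _ bij_betw_inv_into[OF bx]]) (auto simp: bij_betw_def strict_mono_on_imp_inj_on)
  have bb: "bij_betw b {1..n} {..<n}" unfolding b_def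
    using xy(5) by (intro bij_betw_trans[OF _ bij_betw_inv_into[OF by']]) (auto simp: bij_betw_def strict_mono_on_imp_inj_on)
  have xa: "orbit1 v w (a i) = x i" if "i \<in> {1..n}" for i
    using bij_betw_inv_into_right[OF bx] that by (auto simp: a_def)
  have yb: "orbit2 v w (b i) = y i" if "i \<in> {1..n}" for i
    using bij_betw_inv_into_right[OF by'] that by (auto simp: b_def)
  have mem: "a i \<in> {..<n}" "b i \<in> {..<n}" "\<sigma> i \<in> {1..n}" "\<tau> i \<in> {1..n}" if "i \<in> {1..n}" for i
    using that bij_betwE[OF ba] bij_betwE[OF bb] permutes_in_image[OF xy(1)] permutes_in_image[OF xy(2)] by blast+
  have "a i = b (\<sigma> i)" if i: "i \<in> {1..n}" for i
  proof (rule inj_onD[OF crit_loop_inj_orbit2[OF c]])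
    show "orbit2 v w (a i) = orbit2 v w (b (\<sigma> i))"
      using bspec[OF xy'(1) i] xa[OF i] yb[OF mem(3)[OF i]] by (simp add: orbit2_def)
  qed (use mem i in auto)
  moreover have "a (\<tau> j) = Suc (b j) mod n" if j: "j \<in> {1..n}" for j
  proof (rule inj_onD[OF crit_loop_inj[OF c]])
    have "orbit1 v w (Suc (b j)) = q w (y j)" using yb[OF j] by (simp add: orbit1_Suc)
    then show "orbit1 v w (a (\<tau> j)) = orbit1 v w (Suc (b j) mod n)"
      using bspec[OF xy'(2) j] xa[OF mem(4)[OF j]] c by (simp add: orbit1_mod crit_loop_def)
  qed (use mem j in auto)
  ultimately have "itinerary n \<sigma> \<tau> a b" using xy ba bb by (auto simp: itinerary_def)
  moreover have "ordered_by n a b p"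
    unfolding ordered_by_def using xa yb xy(3,5) by (simp add: p strict_mono_on_def)
  ultimately show ?thesis using that c P p by simp
qed

text \<open>For a fixed itinerary, membership amounts to strict inequalities and one closing
  equation. The inequalities keep the first n points distinct, so n is the least period.\<close>

lemma left_boneI:
  assumes it: "itinerary n \<sigma> \<tau> a b" and ord: "ordered_by n a b p" and P: "p \<in> param_space"
    and n: "0 < n" and half: "orbit1 (fst p) (snd p) n = 1/2"
  shows "p \<in> left_bone n \<sigma> \<tau>"
proof -
  obtain v w where p: "p = (v, w)" by force
  have ba: "bij_betw a {1..n} {..<n}" and bb: "bij_betw b {1..n} {..<n}"
    using it by (auto simp: itinerary_def)
  have smx: "strict_mono_on {1..n} (orbit1 v w \<circ> a)" and smy: "strict_mono_on {1..n} (orbit2 v w \<circ> b)"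
    using ord by (auto simp: ordered_by_def strict_mono_on_def p)
  have inj: "inj_on (orbit1 v w) {..<n}"
    using inj_on_imageI2 strict_mono_on_imp_inj_on[OF smx] ba
    by (metis bij_betw_def inj_on_imageI)
  have c: "crit_loop v w n"
    unfolding crit_loop_def
  proof (intro conjI allI impI)
    fix k assume "0 < k \<and> k < n"
    then show "orbit1 v w k \<noteq> 1/2" using inj_onD[OF inj, of k 0] by auto
  qed (use n half p in auto)
  have "has_order_data (q v) (q w) (orbit1 v w ` {..<n}) (orbit2 v w ` {..<n}) n \<sigma> \<tau>"
    unfolding has_order_data_def
  proof (intro conjI, goal_cases)
    case 3
    show ?case
    proof (rule exI[of _ "orbit1 v w \<circ> a"], rule exI[of _ "orbit2 v w \<circ> b"], intro conjI smx smy ballI)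
    show "(orbit1 v w \<circ> a) ` {1..n} = orbit1 v w ` {..<n}" "(orbit2 v w \<circ> b) ` {1..n} = orbit2 v w ` {..<n}"
      using ba bb by (simp_all add: bij_betw_def flip: image_image)
    show "q v ((orbit1 v w \<circ> a) i) = (orbit2 v w \<circ> b) (\<sigma> i)" if "i \<in> {1..n}" for i
      using it that by (auto simp: itinerary_def orbit2_def)
    show "q w ((orbit2 v w \<circ> b) j) = (orbit1 v w \<circ> a) (\<tau> j)" if "j \<in> {1..n}" for j
      using it that half by (auto simp: itinerary_def p orbit1_mod simp flip: orbit1_Suc)
    qed
  qed (use it in \<open>auto simp: itinerary_def\<close>)
  then show ?thesis using c P forward_orbit_eq[OF c]
    by (auto simp: p left_bone_def periodic_on_I1_def least_period_iff_crit_loop orbit2_def image_image)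
qed

section \<open>Uniqueness of the order-data\<close>

lemma strict_mono_on_image_unique:
  fixes x y :: "nat \<Rightarrow> real"
  assumes "strict_mono_on {1..n} x" "strict_mono_on {1..n} y" "x ` {1..n} = y ` {1..n}" "i \<in> {1..n}"
  shows "x i = y i"
proof -
  have "sorted (map x [1..<Suc n])" "distinct (map x [1..<Suc n])"
    if "strict_mono_on {1..n} x" for x :: "nat \<Rightarrow> real"
    using that strict_mono_on_imp_inj_on[OF that] strict_mono_on_leD[OF that]
    by (auto simp: sorted_wrt_map distinct_map sorted_wrt_upt atLeastLessThanSuc_atLeastAtMost
        intro!: sorted_wrt_mono_rel[OF _ sorted_wrt_upt] simp del: upt_Suc)
  then have "map x [1..<Suc n] = map y [1..<Suc n]"
    using assms by (intro sorted_distinct_set_unique) (auto simp del: upt_Suc simp: atLeastLessThanSuc_atLeastAtMost)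
  then show ?thesis using assms(4) by (auto simp del: upt_Suc simp: map_eq_conv)
qed

lemma has_order_data_unique:
  assumes "has_order_data h1 h2 X Y n \<sigma> \<tau>" "has_order_data h1 h2 X Y n \<sigma>' \<tau>'"
  shows "\<sigma> = \<sigma>' \<and> \<tau> = \<tau>'"
proof -
  from assms(1) obtain x y where 1: "\<sigma> permutes {1..n}" "\<tau> permutes {1..n}"
    "strict_mono_on {1..n} x" "x ` {1..n} = X" "strict_mono_on {1..n} y" "y ` {1..n} = Y"
    "\<And>i. i \<in> {1..n} \<Longrightarrow> h1 (x i) = y (\<sigma> i)" "\<And>j. j \<in> {1..n} \<Longrightarrow> h2 (y j) = x (\<tau> j)"
    unfolding has_order_data_def by blast
  from assms(2) obtain x' y' where 2: "\<sigma>' permutes {1..n}" "\<tau>' permutes {1..n}"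
    "strict_mono_on {1..n} x'" "x' ` {1..n} = X" "strict_mono_on {1..n} y'" "y' ` {1..n} = Y"
    "\<And>i. i \<in> {1..n} \<Longrightarrow> h1 (x' i) = y' (\<sigma>' i)" "\<And>j. j \<in> {1..n} \<Longrightarrow> h2 (y' j) = x' (\<tau>' j)"
    unfolding has_order_data_def by blast
  have x: "x i = x' i" and y: "y i = y' i" if "i \<in> {1..n}" for i
    using strict_mono_on_image_unique[of n _ _ i] 1 2 that by auto
  have injx: "inj_on x {1..n}" and injy: "inj_on y {1..n}"
    using 1 strict_mono_on_imp_inj_on by auto
  have mem: "\<sigma> i \<in> {1..n}" "\<sigma>' i \<in> {1..n}" "\<tau> i \<in> {1..n}" "\<tau>' i \<in> {1..n}" if "i \<in> {1..n}" for i
    using that permutes_in_image 1(1,2) 2(1,2) by metis+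
  have "\<sigma> i = \<sigma>' i" for i
  proof (cases "i \<in> {1..n}")
    case True
    then have "y (\<sigma> i) = y (\<sigma>' i)" using 1(7) 2(7) x y mem by metis
    then show ?thesis using injy mem True by (auto dest: inj_onD)
  qed (use 1(1) 2(1) in \<open>auto simp: permutes_def\<close>)
  moreover have "\<tau> i = \<tau>' i" for i
  proof (cases "i \<in> {1..n}")
    case True
    then have "x (\<tau> i) = x (\<tau>' i)" using 1(8) 2(8) x y mem by metis
    then show ?thesis using injx mem True by (auto dest: inj_onD)
  qed (use 1(2) 2(2) in \<open>auto simp: permutes_def\<close>)
  ultimately show ?thesis by auto
qed

text \<open>Distinct bones of the same side are therefore disjoint, and transversality is vacuous
  for them.\<close>

lemma left_bone_unique:
  assumes "p \<in> left_bone n \<sigma> \<tau>" "p \<in> left_bone n' \<sigma>' \<tau>'"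
  shows "n = n' \<and> \<sigma> = \<sigma>' \<and> \<tau> = \<tau>'"
proof -
  have n: "n = n'" using assms unfolding left_bone_def periodic_on_I1_def least_period_def
    by (auto, metis linorder_neqE_nat)
  show ?thesis using assms n has_order_data_unique
    unfolding left_bone_def periodic_on_I1_def by blast
qed

lemma has_order_data_swap:
  "has_order_data h1 h2 X Y n \<sigma> \<tau> \<longleftrightarrow> has_order_data h2 h1 Y X n \<tau> \<sigma>"
  unfolding has_order_data_def by metis

lemma mem_swap_image: "x \<in> prod.swap ` A \<longleftrightarrow> prod.swap x \<in> A"
  by (metis imageE imageI swap_swap)

lemma right_bone_eq: "right_bone n \<sigma> \<tau> = prod.swap ` left_bone n \<tau> \<sigma>"
proof -
  have "periodic_on_I2 (q v) (q w) (1/2) n \<sigma> \<tau> \<longleftrightarrow> periodic_on_I1 (q w) (q v) (1/2) n \<tau> \<sigma>" for v w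
    unfolding periodic_on_I2_def periodic_on_I1_def using has_order_data_swap by metis
  then show ?thesis
    unfolding right_bone_def left_bone_def param_space_def by force
qed

section \<open>Position of the bones in the square and their charts\<close>

lemma frontier_param_space:
  "(v, w) \<in> frontier param_space \<longleftrightarrow> (v, w) \<in> param_space \<and> (v \<in> {0, 1} \<or> w \<in> {0, 1})"
proof -
  have "closed param_space" by (simp add: param_space_def closed_Times)
  moreover have "interior param_space = {0<..<1} \<times> {0<..<1}"
    by (simp add: param_space_def interior_Times)
  ultimately show ?thesis by (auto simp: frontier_def param_space_def closure_closed)
qed

lemma orbit1_stays_0: "orbit1 v w 1 = 0 \<Longrightarrow> 0 < k \<Longrightarrow> orbit1 v w k = 0"
proof (induction k)
  case (Suc k)
  then show ?case by (cases k) (auto simp: orbit1_Suc orbit2_def q_def)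
qed simp

lemma q_bounds:
  assumes "v \<in> {0..1}" "x \<in> {0..1}"
  shows "q v x \<in> {0..1}"
proof -
  have "0 \<le> (1 - 2 * x)\<^sup>2" by simp
  then have "4 * (x * (1 - x)) \<le> 1" by (simp add: power2_eq_square algebra_simps)
  moreover have "0 \<le> x * (1 - x)" using assms by simp
  ultimately have "v * (4 * (x * (1 - x))) \<le> 1 * 1" "0 \<le> v * (4 * (x * (1 - x)))"
    using assms by (intro mult_mono mult_nonneg_nonneg; simp)+
  then show ?thesis by (simp add: q_def mult_ac)
qed

text \<open>The loop cannot reach the common fixed point 0, which excludes all edges but w = 1. The
  number 16vw is the multiplier of the return map at 0: if it were 1, the orbit would never increase
  and would drop below 1/2 at its first step.\<close>

lemma crit_loop_bounds:
  assumes c: "crit_loop v w n" and P: "(v, w) \<in> param_space"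
  shows "0 < v" "v < 1" "0 < w" "w \<le> 1" "16 * v * w \<noteq> 1"
proof -
  have v: "v \<in> {0..1}" and w: "w \<in> {0..1}" using P by (auto simp: param_space_def)
  have n: "0 < n" "orbit1 v w n = 1/2" using c by (auto simp: crit_loop_def)
  then have "orbit1 v w 1 \<noteq> 0" using orbit1_stays_0[of v w n] by auto
  then have *: "q w v \<noteq> 0" by (simp add: orbit1_Suc orbit2_def q_def)
  then show vw: "0 < v" "v < 1" "0 < w" "w \<le> 1" using v w by (auto simp: q_def less_le)
  show "16 * v * w \<noteq> 1"
  proof
    assume eq: "16 * v * w = 1"
    have x01: "orbit1 v w k \<in> {0..1}" for k
      by (induction k) (auto simp: orbit1_Suc orbit2_def simp del: atLeastAtMost_iff intro!: q_bounds v w, simp)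
    have q_le: "q u x \<le> 4 * u * x" if "0 \<le> u" "0 \<le> x" for u x
      using that by (simp add: q_def mult_left_le algebra_simps)
    have le: "orbit1 v w (Suc k) \<le> orbit1 v w k" for k
    proof -
      have "orbit1 v w (Suc k) \<le> 4 * w * orbit2 v w k"
        unfolding orbit1_Suc using x01[of k] vw q_bounds[OF v x01, of k] by (intro q_le) (auto simp: orbit2_def)
      also have "\<dots> \<le> 4 * w * (4 * v * orbit1 v w k)"
        unfolding orbit2_def using x01[of k] vw by (intro mult_left_mono q_le) auto
      also have "\<dots> = (16 * v * w) * orbit1 v w k" by (simp add: algebra_simps)
      finally show ?thesis using eq by simp
    qed
    have "orbit1 v w 1 < 1/2"
    proof -
      have "orbit1 v w 1 = 4 * w * v - 4 * w * v\<^sup>2"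
        by (simp add: orbit1_Suc orbit2_def q_def power2_eq_square algebra_simps)
      moreover have "4 * w * v = 1/4" using eq by (simp add: mult_ac)
      moreover have "0 \<le> w * v\<^sup>2" using vw by simp
      ultimately show ?thesis by linarith
    qed
    moreover have "orbit1 v w n \<le> orbit1 v w 1"
      using decseqD[OF decseq_SucI[of "orbit1 v w", OF le], of 1 n] n(1) by simp
    ultimately show False using n by simp
  qed
qed

text \<open>The inequalities of the itinerary are open, so near \<open>p\<close> only the closing
  equation remains.\<close>

lemma left_bone_local:
  assumes "p \<in> left_bone n \<sigma> \<tau>"
  obtains U where "open U" "p \<in> U"
    "\<And>x. x \<in> U \<Longrightarrow> x \<in> left_bone n \<sigma> \<tau> \<longleftrightarrow> x \<in> param_space \<and> orbit1 (fst x) (snd x) n = 1/2"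
proof -
  obtain a b where ab: "itinerary n \<sigma> \<tau> a b" "ordered_by n a b p"
    and c: "crit_loop (fst p) (snd p) n" and "p \<in> param_space" by (rule left_boneD[OF assms])
  have n: "0 < n" using c by (simp add: crit_loop_def)
  have "x \<in> param_space \<and> orbit1 (fst x) (snd x) n = 1/2" if "x \<in> left_bone n \<sigma> \<tau>" for x
    by (rule left_boneD[OF that]) (simp add: crit_loop_def)
  then show ?thesis
    using ab left_boneI[OF ab(1) _ _ n] by (intro that[OF open_ordered_by[of n a b]]) auto
qed

lemma left_bone_has_chart:
  assumes p: "p \<in> left_bone n \<sigma> \<tau>"
  shows "(\<exists>c c'. C1_chart {-1<..<1} (left_bone n \<sigma> \<tau>) p c c') \<or>
    (p \<in> frontier param_space \<and> (\<exists>c c'. C1_chart {0..<1} (left_bone n \<sigma> \<tau>) p c c'))"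
proof -
  obtain v w where vw: "p = (v, w)" by force
  let ?B = "left_bone n \<sigma> \<tau>"
  let ?F = "\<lambda>x. orbit1 (fst x) (snd x) n - 1/2"
  let ?dv_orbit = "\<lambda>x. dv_orbit (fst x) (snd x) n" and ?dw_orbit = "\<lambda>x. dw_orbit (fst x) (snd x) n"
  have c: "crit_loop v w n" and P: "p \<in> param_space" using left_boneD[OF p] vw by auto
  note bd = crit_loop_bounds[OF c P[unfolded vw]]
  have F0: "?F p = 0" using c by (simp add: vw crit_loop_def)
  have der: "(?F has_derivative (\<lambda>h. ?dv_orbit x * fst h + ?dw_orbit x * snd h)) (at x)" for x
    by (rule derivative_eq_intros has_derivative_orbit1 refl | simp)+
  obtain U where U: "open U" "p \<in> U"
    "\<And>x. x \<in> U \<Longrightarrow> x \<in> ?B \<longleftrightarrow> x \<in> param_space \<and> orbit1 (fst x) (snd x) n = 1/2"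
    by (rule left_bone_local[OF p]) blast
  show ?thesis
  proof (cases "w = 1")
    case True
    let ?U = "U \<inter> {0<..<1} \<times> {0<..}"
    \<comment> \<open>Near \<open>p\<close> the square imposes only w \<le> 1, which is the half
      line \<open>K\<close>. Solving for v is possible by \<open>edge_transversal\<close>.\<close>
    have "\<exists>c c'. C1_chart ({-1<..<1} \<inter> {0..}) ?B p c c'"
    proof (rule implicit_chart[where U = ?U and F = ?F, OF _ _ der continuous_on_D F0])
      show "open ?U" by (intro open_Int U open_Times) auto
      show "p \<in> ?U" using U bd by (auto simp: vw)
      show "?dv_orbit p \<noteq> 0" using edge_transversal[of v n] c bd True by (simp add: vw)
      show "x \<in> ?B \<longleftrightarrow> ?F x = 0 \<and> snd p - snd x \<in> {0..}" if "x \<in> ?U" for x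
        using that U(3)[of x] True by (cases x) (auto simp: vw param_space_def)
    qed (auto simp: zero_le_mult_iff)
    also have "{-1<..<1} \<inter> {0..} = {0..<1::real}" by auto
    finally show ?thesis using P True by (auto simp: vw frontier_param_space)
  next
    case False
    let ?U = "U \<inter> {0<..<1} \<times> {0<..<1}"
    have oU: "open ?U" by (intro open_Int U open_Times) auto
    have pU: "p \<in> ?U" using U bd False by (auto simp: vw)
    have B: "x \<in> ?B \<longleftrightarrow> ?F x = 0" if "x \<in> ?U" for x
      using that U(3)[of x] by (cases x) (auto simp: param_space_def)
    show ?thesis
    proof (cases "?dv_orbit p = 0")
      case F: False
      have "\<exists>c c'. C1_chart ({-1<..<1} \<inter> UNIV) ?B p c c'"
        by (rule implicit_chart[OF oU pU der continuous_on_D F0 F]) (use B in auto)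
      then show ?thesis by simp
    next
      case True
      then have dw_orbit: "?dw_orbit p \<noteq> 0" using gradient_nonzero[OF c] bd by (auto simp: vw)
      \<comment> \<open>Here the equation can only be solved for w: chart the mirror image and
        reflect it back.\<close>
      let ?G = "\<lambda>x. ?F (prod.swap x)"
      have "\<exists>c c'. C1_chart ({-1<..<1} \<inter> UNIV) (prod.swap ` ?B) (prod.swap p) c c'"
      proof (rule implicit_chart[where U = "prod.swap -` ?U" and F = ?G and ?F1.0 = "\<lambda>x. ?dw_orbit (prod.swap x)" and ?F2.0 = "\<lambda>x. ?dv_orbit (prod.swap x)"])
        show "open (prod.swap -` ?U)" by (intro open_vimage oU continuous_on_swap')
        show "prod.swap p \<in> prod.swap -` ?U" using pU by simp
        show "(?G has_derivative (\<lambda>h. ?dw_orbit (prod.swap x) * fst h + ?dv_orbit (prod.swap x) * snd h)) (at x)" for x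
        proof -
          have "(prod.swap has_derivative prod.swap) (at x)"
            unfolding prod.swap_def by (intro has_derivative_Pair has_derivative_fst has_derivative_snd has_derivative_ident)
          from has_derivative_compose[OF this der[of "prod.swap x"]] show ?thesis
            by (simp add: add.commute)
        qed
        show "continuous_on UNIV (\<lambda>x. ?dw_orbit (prod.swap x))" "continuous_on UNIV (\<lambda>x. ?dv_orbit (prod.swap x))"
          by (rule continuous_on_compose2[OF continuous_on_D(2) continuous_on_swap'] continuous_on_compose2[OF continuous_on_D(1) continuous_on_swap']; simp)+
        show "x \<in> prod.swap ` ?B \<longleftrightarrow> ?G x = 0 \<and> snd (prod.swap p) - snd x \<in> UNIV" if "x \<in> prod.swap -` ?U" for x
          using B[of "prod.swap x"] that by (simp add: mem_swap_image)
      qed (use F0 dw_orbit in auto)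
      then obtain g g' where "C1_chart {-1<..<1} (prod.swap ` ?B) (prod.swap p) g g'" by auto
      from C1_chart_swap[OF this] show ?thesis by (auto simp: image_image)
    qed
  qed
qed


subsection \<open>Transversality\<close>

lemma C1_curve_left_bone: "C1_curve_in param_space (left_bone n \<sigma> \<tau>)"
  unfolding C1_curve_in_def using left_bone_has_chart by (auto simp: left_bone_def)

lemma C1_curve_right_bone: "C1_curve_in param_space (right_bone n \<sigma> \<tau>)"
  unfolding C1_curve_in_def
proof (intro conjI ballI)
  show "right_bone n \<sigma> \<tau> \<subseteq> param_space" by (auto simp: right_bone_def)
  fix p assume "p \<in> right_bone n \<sigma> \<tau>"
  then obtain r where r: "r \<in> left_bone n \<tau> \<sigma>" "p = prod.swap r" by (auto simp: right_bone_eq)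
  have "p \<in> frontier param_space" if "r \<in> frontier param_space"
    using that r(2) by (cases r) (simp add: frontier_param_space, auto simp: param_space_def)
  then show "(\<exists>c c'. C1_chart {- 1<..<1} (right_bone n \<sigma> \<tau>) p c c') \<or>
      p \<in> frontier param_space \<and> (\<exists>c c'. C1_chart {0..<1} (right_bone n \<sigma> \<tau>) p c c')"
    using left_bone_has_chart[OF r(1)] C1_chart_swap unfolding right_bone_eq r(2) by blast
qed

text \<open>Both kinds of chart contain \<open>{0..<1}\<close>, along which F is constantly 0; the
  one-sided derivative at 0 is unique, so the chain rule applies to both.\<close>

lemma chart_velocity:
  fixes c :: "real \<Rightarrow> real \<times> real"
  assumes ch: "C1_chart {-1<..<1} B p c c' \<or> C1_chart {0..<1} B p c c'"
    and F: "\<And>x. x \<in> B \<Longrightarrow> F x = (0::real)" "(F has_derivative (\<lambda>h. a * fst h + b * snd h)) (at p)"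
  shows "a * fst (c' 0) + b * snd (c' 0) = 0" "c' 0 \<noteq> 0"
proof -
  have "{0..<1} \<subseteq> {-1<..<1::real}" by auto
  then obtain J where J: "{0..<1} \<subseteq> J" "C1_chart J B p c c'" using ch by blast
  have 0: "0 \<in> J" using J(1) by auto
  have c: "(c has_vector_derivative c' 0) (at 0 within {0..<1})"
    using J 0 by (auto simp: C1_chart_def intro: has_vector_derivative_within_subset)
  show "c' 0 \<noteq> 0" using J(2) 0 by (auto simp: C1_chart_def)
  have p: "c 0 = p" and cB: "c t \<in> B" if "t \<in> J" for t
    using J(2) that by (auto simp: C1_chart_def homeomorphism_def)
  have Fc: "F (c t) = 0" if "t \<in> J" for t using F(1) cB[OF that] by blast
  have "(F has_derivative (\<lambda>h. a * fst h + b * snd h)) (at (c 0))" using F(2) p[OF 0] by simp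
  from has_derivative_compose[OF c[unfolded has_vector_derivative_def] this]
  have "((\<lambda>t. F (c t)) has_vector_derivative (a * fst (c' 0) + b * snd (c' 0))) (at 0 within {0..<1})"
    by (simp add: has_vector_derivative_def algebra_simps)
  moreover have "((\<lambda>t. F (c t)) has_vector_derivative 0) (at 0 within {0..<1})"
    by (rule has_vector_derivative_transform[OF _ _ has_vector_derivative_const[of 0]])
       (use Fc J(1) in auto)
  moreover have "at (0::real) within {0..<1} \<noteq> bot"
    by (simp add: trivial_limit_within islimpt_Ico)
  ultimately show "a * fst (c' 0) + b * snd (c' 0) = 0"
    using vector_derivative_unique_within by blast
qed

lemma tangent_lines_span:
  fixes a b a' b' :: real
  assumes "C1_curve_in P B" "C1_curve_in P' B'" and p: "p \<in> B" "p \<in> B'"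
    and F: "\<And>x. x \<in> B \<Longrightarrow> F x = 0" "(F has_derivative (\<lambda>h. a * fst h + b * snd h)) (at p)"
    and G: "\<And>x. x \<in> B' \<Longrightarrow> G x = 0" "(G has_derivative (\<lambda>h. a' * fst h + b' * snd h)) (at p)"
    and det: "a * b' \<noteq> b * a'"
  shows "{u + u' | u u'. u \<in> tangent_line B p \<and> u' \<in> tangent_line B' p} = UNIV"
proof -
  obtain c c' where c: "C1_chart {-1<..<1} B p c c' \<or> C1_chart {0..<1} B p c c'"
    using assms(1) p unfolding C1_curve_in_def by blast
  obtain d d' where d: "C1_chart {-1<..<1} B' p d d' \<or> C1_chart {0..<1} B' p d d'"
    using assms(2) p unfolding C1_curve_in_def by blast
  obtain u1 u2 v1 v2 where u: "c' 0 = (u1, u2)" and v: "d' 0 = (v1, v2)" by (meson surj_pair)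
  have Fu: "a * u1 + b * u2 = 0" "u1 \<noteq> 0 \<or> u2 \<noteq> 0"
    using chart_velocity[OF c F] u by (auto simp: zero_prod_def)
  have Gv: "a' * v1 + b' * v2 = 0" "v1 \<noteq> 0 \<or> v2 \<noteq> 0"
    using chart_velocity[OF d G] v by (auto simp: zero_prod_def)
  define D where "D = u1 * v2 - u2 * v1"
  \<comment> \<open>Parallel velocities would lie in the kernels of both gradients, which meet only
    in 0.\<close>
  have D: "D \<noteq> 0"
  proof
    assume "D = 0"
    then have e: "u1 * v2 = u2 * v1" by (simp add: D_def)
    have "v1 * (a' * u1 + b' * u2) = u1 * (a' * v1 + b' * v2)" "v2 * (a' * u1 + b' * u2) = u2 * (a' * v1 + b' * v2)"
      using e by algebra+
    then have Gu: "a' * u1 + b' * u2 = 0" using Gv by auto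
    have "(a * b' - b * a') * u1 = b' * (a * u1 + b * u2) - b * (a' * u1 + b' * u2)"
      "(a * b' - b * a') * u2 = a * (a' * u1 + b' * u2) - a' * (a * u1 + b * u2)"
      by (simp_all add: algebra_simps)
    then show False using Fu Gu det by auto
  qed
  have "z \<in> {u + u' | u u'. u \<in> tangent_line B p \<and> u' \<in> tangent_line B' p}" for z
  proof -
    obtain z1 z2 where z: "z = (z1, z2)" by force
    \<comment> \<open>Cramer's rule for z in terms of the two velocities.\<close>
    define s where "s = (z1 * v2 - z2 * v1) / D"
    define t where "t = (u1 * z2 - u2 * z1) / D"
    have "s * u1 + t * v1 = z1 * (D / D)" "s * u2 + t * v2 = z2 * (D / D)"
      unfolding s_def t_def times_divide_eq_left times_divide_eq_right
      by (simp_all add: D_def algebra_simps flip: add_divide_distrib)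
    then have "z = s *\<^sub>R c' 0 + t *\<^sub>R d' 0" using D by (simp add: z u v)
    moreover have "s *\<^sub>R c' 0 \<in> tangent_line B p" "t *\<^sub>R d' 0 \<in> tangent_line B' p"
      using c d unfolding tangent_line_def by blast+
    ultimately show ?thesis by blast
  qed
  then show ?thesis by blast
qed

lemma left_right_span:
  assumes p: "p \<in> left_bone n \<sigma> \<tau>" "p \<in> right_bone m \<sigma>' \<tau>'"
  shows "{u + u' | u u'. u \<in> tangent_line (left_bone n \<sigma> \<tau>) p \<and> u' \<in> tangent_line (right_bone m \<sigma>' \<tau>') p} = UNIV"
proof -
  obtain v w where vw: "p = (v, w)" by force
  have loopL: "crit_loop (fst x) (snd x) n" if "x \<in> left_bone n \<sigma> \<tau>" for x
    using that by (rule left_boneD)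
  have loopR: "crit_loop (snd x) (fst x) m" if "x \<in> right_bone m \<sigma>' \<tau>'" for x
  proof -
    from that obtain r where "r \<in> left_bone m \<tau>' \<sigma>'" "x = prod.swap r" by (auto simp: right_bone_eq)
    then show ?thesis using left_boneD[of r m \<tau>' \<sigma>'] by auto
  qed
  have c: "crit_loop v w n" "crit_loop w v m" using loopL loopR p by (auto simp: vw)
  have "(v, w) \<in> param_space" using p by (auto simp: vw left_bone_def)
  note bd = crit_loop_bounds[OF c(1) this]
  show ?thesis
  proof (rule tangent_lines_span[OF C1_curve_left_bone C1_curve_right_bone p])
    show "orbit1 (fst x) (snd x) n - 1/2 = 0" if "x \<in> left_bone n \<sigma> \<tau>" for x
      using loopL[OF that] by (simp add: crit_loop_def)
    show "((\<lambda>x. orbit1 (fst x) (snd x) n - 1/2) has_derivative (\<lambda>h. dv_orbit v w n * fst h + dw_orbit v w n * snd h)) (at p)"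
      using has_derivative_diff[OF has_derivative_orbit1[of n p] has_derivative_const] by (simp add: vw)
    show "orbit1 (snd x) (fst x) m - 1/2 = 0" if "x \<in> right_bone m \<sigma>' \<tau>'" for x
      using loopR[OF that] by (simp add: crit_loop_def)
    have "(prod.swap has_derivative prod.swap) (at p)"
      unfolding prod.swap_def by (intro has_derivative_Pair has_derivative_fst has_derivative_snd has_derivative_ident)
    from has_derivative_diff[OF has_derivative_compose[OF this has_derivative_orbit1] has_derivative_const]
    show "((\<lambda>x. orbit1 (snd x) (fst x) m - 1/2) has_derivative (\<lambda>h. dw_orbit w v m * fst h + dv_orbit w v m * snd h)) (at p)"
      by (simp add: vw add.commute)
    show "dv_orbit v w n * dv_orbit w v m \<noteq> dw_orbit v w n * dw_orbit w v m"
      using transversal[OF c] bd by auto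
  qed
qed

lemma intersect_transversally_commute:
  "intersect_transversally B B' \<longleftrightarrow> intersect_transversally B' B"
proof -
  have "{u + u' | u u'. u \<in> X \<and> u' \<in> Y} \<subseteq> {u + u' | u u'. u \<in> Y \<and> u' \<in> X}" for X Y :: "'a set"
    by clarify (metis add.commute)
  then have "{u + u' | u u'. u \<in> X \<and> u' \<in> Y} = {u + u' | u u'. u \<in> Y \<and> u' \<in> X}" for X Y :: "'a set"
    by (intro subset_antisym)
  then show ?thesis unfolding intersect_transversally_def Int_commute[of B] by simp
qed

lemma left_right_transversal:
  "intersect_transversally (left_bone n \<sigma> \<tau>) (right_bone m \<sigma>' \<tau>')"
  unfolding intersect_transversally_def using left_right_span by blast

lemma disjoint_transversal: "B \<inter> B' = {} \<Longrightarrow> intersect_transversally B B'"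
  by (simp add: intersect_transversally_def)

lemma right_bone_unique:
  assumes "p \<in> right_bone n \<sigma> \<tau>" "p \<in> right_bone n' \<sigma>' \<tau>'"
  shows "n = n' \<and> \<sigma> = \<sigma>' \<and> \<tau> = \<tau>'"
  using assms left_bone_unique[of "prod.swap p"] by (auto simp: right_bone_eq mem_swap_image)

theorem theorem4p1:
  "(\<forall>s n \<sigma> \<tau>. admissible n \<sigma> \<tau> \<longrightarrow> C1_curve_in param_space (bone s n \<sigma> \<tau>)) \<and>
   (\<forall>s n \<sigma> \<tau> s' n' \<sigma>' \<tau>'.
      admissible n \<sigma> \<tau> \<longrightarrow> admissible n' \<sigma>' \<tau>' \<longrightarrow>
      (s, n, \<sigma>, \<tau>) \<noteq> (s', n', \<sigma>', \<tau>') \<longrightarrow>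
      intersect_transversally (bone s n \<sigma> \<tau>) (bone s' n' \<sigma>' \<tau>'))"
proof (intro conjI allI impI)
  fix s :: side and n :: nat and \<sigma> \<tau> :: "nat \<Rightarrow> nat"
  show "C1_curve_in param_space (bone s n \<sigma> \<tau>)"
    by (cases s) (simp_all add: C1_curve_left_bone C1_curve_right_bone)
next
  fix s s' :: side and n n' :: nat and \<sigma> \<tau> \<sigma>' \<tau>' :: "nat \<Rightarrow> nat"
  assume ne: "(s, n, \<sigma>, \<tau>) \<noteq> (s', n', \<sigma>', \<tau>')"
  show "intersect_transversally (bone s n \<sigma> \<tau>) (bone s' n' \<sigma>' \<tau>')"
  proof (cases s; cases s')
    assume s: "s = LeftSide" "s' = LeftSide"
    then have "left_bone n \<sigma> \<tau> \<inter> left_bone n' \<sigma>' \<tau>' = {}"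
      using ne left_bone_unique by blast
    then show ?thesis by (simp add: s disjoint_transversal)
  next
    assume s: "s = RightSide" "s' = RightSide"
    then have "right_bone n \<sigma> \<tau> \<inter> right_bone n' \<sigma>' \<tau>' = {}"
      using ne right_bone_unique by blast
    then show ?thesis by (simp add: s disjoint_transversal)
  next
    assume s: "s = LeftSide" "s' = RightSide"
    then show ?thesis by (simp add: left_right_transversal)
  next
    assume s: "s = RightSide" "s' = LeftSide"
    then show ?thesis
      by (simp add: left_right_transversal intersect_transversally_commute[of "right_bone n \<sigma> \<tau>"])
  qed
qed

end
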